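(* Let $\Gamma$ be a finitely generated periodic group of $C^1$-diffeomorphisms of the $2$-sphere $\mathbb{S}^2$. If $\Gamma$ has a finite orbit in $\mathbb{S}^2$ (that is, there is $x\in\mathbb{S}^2$ such that $\{g(x): g\in\Gamma\}$ is finite), then $\Gamma$ is finite. Moreover, if $\Gamma$ consists of orientation preserving $C^1$-diffeomorphisms and acts with a global fixed point (a point $x\in \mathbb{S}^2$ with $g(x)=x$ for all $g\in\Gamma$), then $\Gamma$ is abelian.
   Context: A group $\Gamma$ is periodic if every $g\in\Gamma$ has finite order, i.e. there is a positive integer $n$ with $g^n=\mathrm{id}$. A group of $C^1$-diffeomorphisms of $\mathbb{S}^2$ is a subgroup of the group $\mathrm{Diff}^1(\mathbb{S}^2)$ of all $C^1$-diffeomorphisms of $\mathbb{S}^2$, under composition. *)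

theory Defs
  imports
    "HOL-Analysis.Analysis"
    "HOL-Algebra.Bij"
    "HOL-Algebra.Generated_Groups"
begin

section \<open>\<open>C\<^sup>1\<close> maps on subsets of Euclidean space\<close>

text \<open>
  A map on a subset \<open>S\<close> of a Euclidean space is \<open>C\<^sup>1\<close> if it extends, near every point of \<open>S\<close>,
  to a \<open>C\<^sup>1\<close> map on an open subset of the ambient space.  For an embedded submanifold this
  is the usual notion of a \<open>C\<^sup>1\<close> map.  Only the values of \<open>f\<close> on \<open>S\<close> matter.
\<close>

definition C1_on :: "'a::euclidean_space set \<Rightarrow> ('a \<Rightarrow> 'b::euclidean_space) \<Rightarrow> bool"
  where "C1_on S f \<longleftrightarrow>
    (\<forall>x\<in>S. \<exists>U F F'. open U \<and> x \<in> U \<and>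
      (\<forall>y\<in>U. (F has_derivative blinfun_apply (F' y)) (at y)) \<and>
      continuous_on U F' \<and>
      (\<forall>y\<in>U \<inter> S. F y = f y))"

lemma C1_onI:
  assumes "\<And>x. x \<in> S \<Longrightarrow> \<exists>U F F'. open U \<and> x \<in> U \<and>
      (\<forall>y\<in>U. (F has_derivative blinfun_apply (F' y)) (at y)) \<and>
      continuous_on U F' \<and> (\<forall>y\<in>U \<inter> S. F y = f y)"
  shows "C1_on S f"
  unfolding C1_on_def by (rule ballI, rule assms)

lemma C1_onE:
  assumes "C1_on S f" and "x \<in> S"
  obtains U F F' where "open U" "x \<in> U"
    "\<forall>y\<in>U. (F has_derivative blinfun_apply (F' y)) (at y)"
    "continuous_on U F'" "\<forall>y\<in>U \<inter> S. F y = f y"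
proof -
  have "\<exists>U F F'. open U \<and> x \<in> U \<and>
      (\<forall>y\<in>U. (F has_derivative blinfun_apply (F' y)) (at y)) \<and>
      continuous_on U F' \<and> (\<forall>y\<in>U \<inter> S. F y = f y)"
    using assms(1)[unfolded C1_on_def] assms(2) by (rule bspec)
  then show thesis
  proof (elim exE conjE, goal_cases)
    case (1 U F F')
    show thesis
      by (rule that[OF 1(1,2) 1(3) 1(4) 1(5)])
  qed
qed

lemma C1_on_cong:
  assumes f: "C1_on S f" and eq: "\<And>x. x \<in> S \<Longrightarrow> g x = f x"
  shows "C1_on S g"
proof (rule C1_onI)
  fix x assume "x \<in> S"
  with f obtain U F F' where U: "open U" "x \<in> U"
    "\<forall>y\<in>U. (F has_derivative blinfun_apply (F' y)) (at y)"
    "continuous_on U F'" "\<forall>y\<in>U \<inter> S. F y = f y"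
    by (rule C1_onE)
  show "\<exists>U F F'. open U \<and> x \<in> U \<and>
      (\<forall>y\<in>U. (F has_derivative blinfun_apply (F' y)) (at y)) \<and>
      continuous_on U F' \<and> (\<forall>y\<in>U \<inter> S. F y = g y)"
    by (intro exI[of _ U] exI[of _ F] exI[of _ F'] conjI ballI) (use U eq in simp_all)
qed

lemma C1_on_ident: "C1_on S (\<lambda>x. x)"
proof (rule C1_onI)
  fix x assume "x \<in> S"
  show "\<exists>U F F'. open U \<and> x \<in> U \<and>
      (\<forall>y\<in>U. (F has_derivative blinfun_apply (F' y)) (at y)) \<and>
      continuous_on U F' \<and> (\<forall>y\<in>U \<inter> S. F y = y)"
    by (intro exI[of _ UNIV] exI[of _ "\<lambda>x. x"] exI[of _ "\<lambda>_. id_blinfun"])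
       (simp add: has_derivative_ident)
qed

lemma C1_on_compose:
  assumes f: "C1_on S f" and g: "C1_on T g" and fST: "f ` S \<subseteq> T"
  shows "C1_on S (\<lambda>x. g (f x))"
proof (rule C1_onI)
  fix x assume x: "x \<in> S"
  obtain U F F' where U: "open U" "x \<in> U"
    and F: "\<forall>y\<in>U. (F has_derivative blinfun_apply (F' y)) (at y)"
    and F': "continuous_on U F'" and Ff: "\<forall>y\<in>U \<inter> S. F y = f y"
    using f x by (rule C1_onE)
  have "f x \<in> T" using x fST by blast
  with g obtain V G G' where V: "open V" "f x \<in> V"
    and G: "\<forall>y\<in>V. (G has_derivative blinfun_apply (G' y)) (at y)"
    and G': "continuous_on V G'" and Gg: "\<forall>y\<in>V \<inter> T. G y = g y"
    by (rule C1_onE)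
  define W where "W = U \<inter> F -` V"
  have contF: "continuous_on U F"
    using F by (meson continuous_at_imp_continuous_on has_derivative_continuous)
  have "open W"
    unfolding W_def using contF U(1) V(1) by (rule continuous_open_preimage)
  moreover have "x \<in> W"
    using U V Ff x by (simp add: W_def)
  moreover have "((\<lambda>z. G (F z)) has_derivative blinfun_apply (G' (F y) o\<^sub>L F' y)) (at y)"
    if "y \<in> W" for y
  proof -
    have "(F has_derivative F' y) (at y)" "(G has_derivative G' (F y)) (at (F y))"
      using that F G by (auto simp: W_def)
    from has_derivative_compose[OF this] show ?thesis
      by (simp add: blinfun_compose.rep_eq o_def)
  qed
  moreover have "continuous_on W (\<lambda>y. G' (F y) o\<^sub>L F' y)"
  proof (rule bounded_bilinear.continuous_on[OF bounded_bilinear_blinfun_compose])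
    show "continuous_on W (\<lambda>y. G' (F y))"
      by (rule continuous_on_compose2[OF G' continuous_on_subset[OF contF]]) (auto simp: W_def)
    show "continuous_on W F'"
      using F' by (rule continuous_on_subset) (auto simp: W_def)
  qed
  moreover have "G (F y) = g (f y)" if "y \<in> W \<inter> S" for y
    using that fST Ff Gg by (auto simp: W_def)
  ultimately show "\<exists>U H H'. open U \<and> x \<in> U \<and>
      (\<forall>y\<in>U. (H has_derivative blinfun_apply (H' y)) (at y)) \<and>
      continuous_on U H' \<and> (\<forall>y\<in>U \<inter> S. H y = g (f y))"
    by (intro exI[of _ W] exI[of _ "\<lambda>z. G (F z)"] exI[of _ "\<lambda>y. G' (F y) o\<^sub>L F' y"]) simp
qed


section \<open>The group of \<open>C\<^sup>1\<close>-diffeomorphisms\<close>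

text \<open>
  Elements of \<^const>\<open>BijGroup\<close> are extensional, so a diffeomorphism of \<open>S\<close> is represented by
  exactly one function on the ambient space; the group operation is composition.
\<close>

definition C1_diffeos :: "'a::euclidean_space set \<Rightarrow> ('a \<Rightarrow> 'a) set"
  where "C1_diffeos S = {f \<in> Bij S. C1_on S f \<and> C1_on S (inv_into S f)}"

definition Diff1 :: "'a::euclidean_space set \<Rightarrow> ('a \<Rightarrow> 'a) monoid"
  where "Diff1 S = BijGroup S\<lparr>carrier := C1_diffeos S\<rparr>"

lemma inv_BijGroup:
  assumes "f \<in> Bij S"
  shows "inv\<^bsub>BijGroup S\<^esub> f = restrict (inv_into S f) S"
proof (rule group.inv_equality[OF group_BijGroup])
  show "restrict (inv_into S f) S \<otimes>\<^bsub>BijGroup S\<^esub> f = \<one>\<^bsub>BijGroup S\<^esub>"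
    using assms by (simp add: BijGroup_def restrict_inv_into_Bij Bij_compose_restrict_eq)
qed (use assms in \<open>simp_all add: BijGroup_def restrict_inv_into_Bij\<close>)

lemma subgroup_C1_diffeos: "subgroup (C1_diffeos S) (BijGroup S)"
proof (rule group.subgroupI[OF group_BijGroup])
  show "C1_diffeos S \<subseteq> carrier (BijGroup S)"
    by (auto simp: C1_diffeos_def BijGroup_def)
  have "inv_into S (\<lambda>x\<in>S. x) x = x" if "x \<in> S" for x
    using that by (intro inv_into_f_eq) (auto simp: inj_on_def)
  then have "C1_on S (inv_into S (\<lambda>x\<in>S. x))"
    by (rule C1_on_cong[OF C1_on_ident])
  moreover have "C1_on S (\<lambda>x\<in>S. x)"
    by (rule C1_on_cong[OF C1_on_ident]) simp
  ultimately show "C1_diffeos S \<noteq> {}"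
    using id_Bij[of S] by (auto simp: C1_diffeos_def)
next
  fix f assume f: "f \<in> C1_diffeos S"
  then have fB: "f \<in> Bij S" and bij: "bij_betw f S S"
    by (auto simp: C1_diffeos_def Bij_def)
  have "inv_into S (restrict (inv_into S f) S) x = f x" if "x \<in> S" for x
  proof (rule inv_into_f_eq)
    show "inj_on (restrict (inv_into S f) S) S"
      using restrict_inv_into_Bij[OF fB] by (simp add: Bij_def bij_betw_def)
    show "f x \<in> S" using that bij by (rule bij_betwE[rule_format, rotated])
    then show "restrict (inv_into S f) S (f x) = x"
      using that bij by (simp add: bij_betw_inv_into_left)
  qed
  then have "C1_on S (inv_into S (restrict (inv_into S f) S))"
    by (rule C1_on_cong[of S f, rotated]) (use f in \<open>auto simp: C1_diffeos_def\<close>)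
  moreover have "C1_on S (restrict (inv_into S f) S)"
    by (rule C1_on_cong[of S "inv_into S f"]) (use f in \<open>auto simp: C1_diffeos_def\<close>)
  ultimately show "inv\<^bsub>BijGroup S\<^esub> f \<in> C1_diffeos S"
    using fB by (simp add: inv_BijGroup C1_diffeos_def restrict_inv_into_Bij)
next
  fix f g assume fg: "f \<in> C1_diffeos S" "g \<in> C1_diffeos S"
  then have B: "f \<in> Bij S" "g \<in> Bij S" and bij: "bij_betw f S S" "bij_betw g S S"
    and C: "C1_on S f" "C1_on S g" "C1_on S (inv_into S f)" "C1_on S (inv_into S g)"
    by (auto simp: C1_diffeos_def Bij_def)
  have "C1_on S (\<lambda>x. f (g x))"
    by (rule C1_on_compose[OF C(2,1)]) (use bij in \<open>simp add: bij_betw_imp_surj_on\<close>)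
  then have 1: "C1_on S (compose S f g)"
    by (rule C1_on_cong) (simp add: compose_eq)
  have eq: "inv_into S (compose S f g) x = inv_into S g (inv_into S f x)" if x: "x \<in> S" for x
  proof (rule inv_into_f_eq)
    have mem: "inv_into S f x \<in> S" "inv_into S g (inv_into S f x) \<in> S"
      using x bij by (simp_all add: bij_betw_imp_surj_on inv_into_into)
    show "inj_on (compose S f g) S"
      using compose_Bij[OF B] by (simp add: Bij_def bij_betw_def)
    show "inv_into S g (inv_into S f x) \<in> S" by fact
    show "compose S f g (inv_into S g (inv_into S f x)) = x"
      using mem x bij by (simp add: compose_def bij_betw_inv_into_right)
  qed
  have "inv_into S f ` S \<subseteq> S"
    using bij_betw_inv_into[OF bij(1)] by (simp add: bij_betw_imp_surj_on)
  then have "C1_on S (\<lambda>x. inv_into S g (inv_into S f x))"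
    by (rule C1_on_compose[OF C(3,4)])
  then have 2: "C1_on S (inv_into S (compose S f g))"
    using eq by (rule C1_on_cong)
  show "f \<otimes>\<^bsub>BijGroup S\<^esub> g \<in> C1_diffeos S"
    using 1 2 B by (simp add: C1_diffeos_def BijGroup_def compose_Bij)
qed

lemma group_Diff1: "group (Diff1 S)"
  unfolding Diff1_def
  by (rule subgroup.subgroup_is_group[OF subgroup_C1_diffeos group_BijGroup])


section \<open>The 2-sphere and orientation\<close>

abbreviation S2 :: "(real^3) set"
  where "S2 \<equiv> sphere 0 1"

text \<open>
  \<open>S2\<close> is oriented by the outward normal: a basis \<open>(u, v)\<close> of the tangent plane
  \<open>{w. x \<bullet> w = 0}\<close> at \<open>x\<close> is positive iff \<open>det (x, u, v) > 0\<close>.  A derivative of \<open>f\<close> at \<open>x\<close>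
  within \<open>S2\<close> is unique only on the tangent plane, but \<open>D\<close> is applied to tangent vectors only.
\<close>

definition orientation_preserving :: "(real^3 \<Rightarrow> real^3) \<Rightarrow> bool"
  where "orientation_preserving f \<longleftrightarrow>
    (\<forall>x\<in>S2. \<exists>D. (f has_derivative D) (at x within S2) \<and>
      (\<forall>u v. x \<bullet> u = 0 \<and> x \<bullet> v = 0 \<and> det (vector [x, u, v] :: real^3^3) > 0
        \<longrightarrow> det (vector [f x, D u, D v] :: real^3^3) > 0))"


section \<open>Finitely generated and periodic subgroups\<close>

definition finitely_generated_in :: "('a, 'b) monoid_scheme \<Rightarrow> 'a set \<Rightarrow> bool"
  where "finitely_generated_in G H \<longleftrightarrow> (\<exists>A. finite A \<and> A \<subseteq> carrier G \<and> generate G A = H)"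

definition periodic_in :: "('a, 'b) monoid_scheme \<Rightarrow> 'a set \<Rightarrow> bool"
  where "periodic_in G H \<longleftrightarrow> (\<forall>g\<in>H. \<exists>n::nat. n > 0 \<and> g [^]\<^bsub>G\<^esub> n = \<one>\<^bsub>G\<^esub>)"

end

theory Submission
  imports Defs
begin

text \<open>
  The proof linearises the group at a point of a finite orbit.  The stabiliser \<open>K\<close> of that point
  \<open>x\<close> has finite index in \<open>\<Gamma>\<close>, and each \<open>g \<in> K\<close> has a derivative on the tangent plane at \<open>x\<close>; this
  gives a homomorphism from \<open>K\<close> to \<open>GL(2,\<real>)\<close>.  Two facts turn it into a proof.

  The homomorphism is injective on periodic groups.  If \<open>f\<close> has finite order \<open>n\<close>, fixes \<open>x\<close>, and has
  derivative \<open>id\<close> there, then \<open>h = id + f + \<dots> + f\<^sup>n\<^sup>-\<^sup>1\<close> has the invertible derivative \<open>n \<cdot> id\<close> at \<open>x\<close> and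
  satisfies \<open>h \<circ> f = h\<close>.  So \<open>h\<close> is injective near \<open>x\<close>, and \<open>f\<close> is the identity near \<open>x\<close>.  Hence the points
  where \<open>f\<close> is the identity to first order form an open and closed set, and \<open>f\<close> is the identity
  (\<open>finite_order_C1_rigid\<close>).

  The elements of a periodic subgroup of \<open>SL(2,\<real>)\<close> commute.  A matrix of finite order and
  determinant 1 is a scalar or has trace of absolute value below 2.  If \<open>A\<close> is of the second kind,
  the commutator of \<open>A\<close> and \<open>B\<close> has trace at least 2, with equality only if \<open>A\<close> and \<open>B\<close> commute; since
  the commutator has finite order as well, its trace is at most 2 (\<open>SL2_finite_order_commute\<close>).
  For these groups this elementary argument replaces Schur's theorem on periodic linear groups.

  Elements of finite order have determinant \<open>\<plusminus>1\<close>, and determinant 1 if they preserve orientation.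
  Thus an orientation preserving \<open>\<Gamma>\<close> that fixes \<open>x\<close> is abelian.  In general, the elements of \<open>K\<close> with
  positive determinant form an abelian subgroup \<open>L\<close> of finite index in \<open>\<Gamma>\<close>.  By Schreier's lemma \<open>L\<close> is
  finitely generated, and a finitely generated periodic abelian group is finite; so \<open>\<Gamma>\<close> is finite.

  Charts are avoided by extending each diffeomorphism \<open>g\<close> of the sphere to the punctured space
  \<open>-{0}\<close> by \<open>y \<mapsto> |y| g(y/|y|)\<close>.  This respects composition, and the extension is a \<open>C\<^sup>1\<close> map on a connected open
  set, with a derivative that is unique.
\<close>

section \<open>Calculus of \<open>C\<^sup>1\<close> maps\<close>

lemma C1_onI_derivative:
  assumes "open S" "\<And>y. y \<in> S \<Longrightarrow> (f has_derivative blinfun_apply (f' y)) (at y)" "continuous_on S f'"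
  shows "C1_on S f"
  by (rule C1_onI, intro exI[of _ S] exI[of _ f] exI[of _ f']) (use assms in auto)

text \<open>
  On an open set the local extensions in the definition are the map itself, so that their
  continuous derivatives agree and glue to one derivative on the whole set.
\<close>

lemma C1_on_open_derivative:
  assumes f: "C1_on S f" and S: "open S"
  obtains f' where "\<And>y. y \<in> S \<Longrightarrow> (f has_derivative blinfun_apply (f' y)) (at y)"
    "continuous_on S f'"
proof -
  define f' where "f' y = Blinfun (frechet_derivative f (at y))" for y
  have loc: "\<exists>V. open V \<and> x \<in> V \<and> continuous_on V f' \<and> (\<forall>y\<in>V. (f has_derivative blinfun_apply (f' y)) (at y))"
    if x: "x \<in> S" for x
  proof -
    obtain U F F' where U: "open U" "x \<in> U"
      and F: "\<forall>y\<in>U. (F has_derivative blinfun_apply (F' y)) (at y)"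
      and F': "continuous_on U F'" and Ff: "\<forall>y\<in>U \<inter> S. F y = f y"
      using f x by (rule C1_onE)
    have der: "(f has_derivative blinfun_apply (F' y)) (at y)" if y: "y \<in> U \<inter> S" for y
      by (rule has_derivative_transform_within_open[of F _ _ _ "U \<inter> S"]) (use F Ff U S y in auto)
    have eq: "f' y = F' y" if "y \<in> U \<inter> S" for y
      by (simp add: f'_def frechet_derivative_at[OF der[OF that], symmetric] blinfun_apply_inverse)
    show ?thesis
    proof (intro exI[of _ "U \<inter> S"] conjI ballI)
      show "continuous_on (U \<inter> S) f'"
        by (rule continuous_on_eq[OF continuous_on_subset[OF F']]) (use eq in auto)
    qed (use U S x der eq in auto)
  qed
  have "continuous_on S f'"
  proof (rule continuous_at_imp_continuous_on, rule ballI)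
    fix x assume "x \<in> S"
    with loc show "isCont f' x" by (meson continuous_on_eq_continuous_at)
  qed
  with loc that show thesis by blast
qed

lemma C1_on_funpow:
  assumes "C1_on S f" "f ` S \<subseteq> S"
  shows "C1_on S (f ^^ k)"
proof (induction k)
  case (Suc k)
  have "(f ^^ k) ` S \<subseteq> S" using assms(2) by (induction k) auto
  from C1_on_compose[OF Suc assms(1) this] show ?case by simp
qed (simp add: C1_on_ident id_def)

lemma C1_on_scaleR:
  assumes S: "open S" and f: "C1_on S f" and g: "C1_on S g"
  shows "C1_on S (\<lambda>x. f x *\<^sub>R g x)"
proof -
  obtain f' where f': "\<And>y. y \<in> S \<Longrightarrow> (f has_derivative blinfun_apply (f' y)) (at y)" "continuous_on S f'"
    using C1_on_open_derivative[OF f S] by blast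
  obtain g' where g': "\<And>y. y \<in> S \<Longrightarrow> (g has_derivative blinfun_apply (g' y)) (at y)" "continuous_on S g'"
    using C1_on_open_derivative[OF g S] by blast
  have cf: "continuous_on S f" "continuous_on S g"
    using f'(1) g'(1) by (meson continuous_at_imp_continuous_on has_derivative_continuous)+
  show ?thesis
  proof (rule C1_onI_derivative[OF S, where f' = "\<lambda>y. f y *\<^sub>R g' y + (blinfun_scaleR_left (g y) o\<^sub>L f' y)"])
    fix y assume y: "y \<in> S"
    show "((\<lambda>x. f x *\<^sub>R g x) has_derivative blinfun_apply (f y *\<^sub>R g' y + (blinfun_scaleR_left (g y) o\<^sub>L f' y))) (at y)"
      by (rule has_derivative_eq_rhs[OF has_derivative_scaleR[OF f'(1)[OF y] g'(1)[OF y]]])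
        (simp add: fun_eq_iff plus_blinfun.rep_eq scaleR_blinfun.rep_eq)
  next
    show "continuous_on S (\<lambda>y. f y *\<^sub>R g' y + (blinfun_scaleR_left (g y) o\<^sub>L f' y))"
      using cf f'(2) g'(2)
      by (intro continuous_intros bounded_linear.continuous_on[OF bounded_linear_blinfun_scaleR_left])
  qed
qed

lemma C1_on_norm: "C1_on (-{0}) (norm :: 'a::euclidean_space \<Rightarrow> real)"
proof (rule C1_onI_derivative)
  show "(norm has_derivative blinfun_apply (blinfun_inner_left (sgn y))) (at y)" if "y \<in> -{0}" for y :: 'a
    using has_derivative_norm[of y] that by simp
  show "continuous_on (-{0}) (\<lambda>y::'a. blinfun_inner_left (sgn y))"
    by (intro bounded_linear.continuous_on[OF bounded_linear_blinfun_inner_left] continuous_intros) auto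
qed auto

lemma C1_on_inverse: "C1_on (-{0}) (inverse :: real \<Rightarrow> real)"
proof (rule C1_onI_derivative)
  show "(inverse has_derivative blinfun_apply (blinfun_scaleR_left (- (inverse y * inverse y)))) (at y)"
    if "y \<in> -{0}" for y :: real
    by (rule has_derivative_eq_rhs[OF has_derivative_inverse'])
      (use that in \<open>auto simp: fun_eq_iff\<close>)
  show "continuous_on (-{0}) (\<lambda>y::real. blinfun_scaleR_left (- (inverse y * inverse y)))"
    by (intro bounded_linear.continuous_on[OF bounded_linear_blinfun_scaleR_left] continuous_intros) auto
qed auto

lemma C1_on_sgn: "C1_on (-{0}) (sgn :: 'a::euclidean_space \<Rightarrow> 'a)"
proof -
  have "C1_on (-{0}) (\<lambda>x::'a. inverse (norm x) *\<^sub>R x)"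
    by (intro C1_on_scaleR C1_on_ident C1_on_compose[OF C1_on_norm C1_on_inverse]) auto
  then show ?thesis by (rule C1_on_cong) (simp add: sgn_div_norm)
qed

section \<open>Rigidity of finite order maps\<close>

text \<open>
  A finite order map is conjugate to its derivative near a fixed point, by averaging over the
  cyclic group that it generates.  When the derivative is the identity, the average is proportional
  to the sum \<open>h\<close> of the iterates, and local injectivity of \<open>h\<close> suffices.
\<close>

lemma finite_order_C1_locally_id:
  fixes f :: "'a::euclidean_space \<Rightarrow> 'a"
  assumes S: "open S" and f: "C1_on S f" "f ` S \<subseteq> S"
    and n: "n > 0" "\<And>y. y \<in> S \<Longrightarrow> (f ^^ n) y = y"
    and x: "x \<in> S" "f x = x" "(f has_derivative id) (at x)"
  shows "\<forall>\<^sub>F y in nhds x. f y = y"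
proof -
  have "\<exists>D. (\<forall>y\<in>S. ((f ^^ k) has_derivative blinfun_apply (D y)) (at y)) \<and> continuous_on S D" for k
    by (rule C1_on_open_derivative[OF C1_on_funpow[OF f, of k] S]) blast
  then obtain D where D: "\<And>k y. y \<in> S \<Longrightarrow> ((f ^^ k) has_derivative blinfun_apply (D k y)) (at y)"
    and cD: "\<And>k. continuous_on S (D k)" by metis
  \<comment> \<open>Replacing \<open>y\<close> by \<open>f y\<close> permutes the summands cyclically, so \<open>h (f y) = h y\<close>.\<close>
  define h where "h y = (\<Sum>k<n. (f ^^ k) y)" for y
  define h' where "h' y = (\<Sum>k<n. D k y)" for y
  have hder: "(h has_derivative blinfun_apply (h' y)) (at y)" if "y \<in> S" for y
    unfolding h_def h'_def
    by (rule has_derivative_eq_rhs[OF has_derivative_sum[where f' = "\<lambda>k. blinfun_apply (D k y)"]])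
      (use D that in \<open>auto simp: fun_eq_iff blinfun.sum_left\<close>)
  have ch: "continuous_on S h'"
    unfolding h'_def by (intro continuous_on_sum cD)
  have pow_id: "(f ^^ k) x = x \<and> ((f ^^ k) has_derivative id) (at x)" for k
  proof (induction k)
    case 0 then show ?case by (simp add: id_def)
  next
    case (Suc k)
    then have *: "((f ^^ k) has_derivative id) (at x)" by (rule conjunct2)
    have "(f has_derivative id) (at ((f ^^ k) x))" using x(3) Suc by auto
    from has_derivative_compose[OF * this] show ?case using Suc x by (simp add: o_def id_def)
  qed
  have Dx: "blinfun_apply (D k x) v = v" for k v
    using has_derivative_unique[OF D[OF x(1), of k] conjunct2[OF pow_id[of k]]] by simp
  have h'x: "blinfun_apply (h' x) v = real n *\<^sub>R v" for v
    by (simp add: h'_def blinfun.sum_left Dx scaleR_conv_of_real sum_constant_scaleR)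
  have "\<exists>r>0. ball x r \<subseteq> S \<and> inj_on h (ball x r)"
  \<comment> \<open>The derivative of \<open>h\<close> at \<open>x\<close> is \<open>n\<close> times the identity.\<close>
  proof (rule has_derivative_locally_injective[of x S "\<lambda>v. v /\<^sub>R real n" "\<lambda>y. blinfun_apply (h' y)" h])
    show "(\<lambda>v. v /\<^sub>R real n) \<circ> blinfun_apply (h' x) = id"
      using n(1) by (auto simp: fun_eq_iff h'x)
    show "\<exists>d>0. \<forall>y. dist x y < d \<longrightarrow> onorm (\<lambda>v. blinfun_apply (h' y) v - blinfun_apply (h' x) v) < e"
      if "e > 0" for e
    proof -
      have "isCont h' x" using ch x(1) unfolding continuous_on_eq_continuous_at[OF S] by blast
      then have "\<exists>d>0. \<forall>y. dist y x < d \<longrightarrow> dist (h' y) (h' x) < e"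
        unfolding continuous_at_eps_delta using that by (elim allE impE)
      moreover have "dist (h' y) (h' x) = onorm (\<lambda>v. blinfun_apply (h' y) v - blinfun_apply (h' x) v)" for y
        by (simp add: dist_norm norm_blinfun.rep_eq minus_blinfun.rep_eq)
      ultimately show ?thesis by (simp add: dist_commute)
    qed
  qed (use S x hder in \<open>blast intro: bounded_linear_scaleR_right\<close>)+
  then obtain r where r: "r > 0" "ball x r \<subseteq> S" "inj_on h (ball x r)" by blast
  have hf: "h (f y) = h y" if "y \<in> S" for y
  proof -
    have "h (f y) = (\<Sum>k<n. (f ^^ Suc k) y)" by (simp add: h_def funpow_swap1)
    also have "\<dots> = (\<Sum>k<Suc n. (f ^^ k) y) - y" by (subst sum.lessThan_Suc_shift) simp
    also have "\<dots> = h y" using n(2)[OF that] by (simp add: h_def del: funpow.simps(2))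
    finally show ?thesis .
  qed
  have "isCont f x" using x(3) by (rule has_derivative_continuous)
  then have "(f \<longlongrightarrow> f x) (nhds x)" unfolding isCont_def tendsto_at_iff_tendsto_nhds .
  from topological_tendstoD[OF this open_ball, of x r] have "\<forall>\<^sub>F y in nhds x. f y \<in> ball x r"
    using r(1) x(2) by simp
  moreover have "\<forall>\<^sub>F y in nhds x. y \<in> ball x r"
    using r(1) by (intro eventually_nhds_in_open) auto
  ultimately show ?thesis
  proof eventually_elim
    case (elim y)
    then show ?case using r hf by (meson inj_onD subsetD)
  qed
qed

text \<open>
  Being the identity to first order at a point is a closed condition by continuity of \<open>f\<close> and its
  derivative, and an open one by the local statement.  Agreement of the values alone would not be
  open: a reflection fixes a hyperplane.
\<close>

theorem finite_order_C1_rigid: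
  fixes f :: "'a::euclidean_space \<Rightarrow> 'a"
  assumes S: "open S" "connected S" and f: "C1_on S f" "f ` S \<subseteq> S"
    and n: "n > 0" "\<And>y. y \<in> S \<Longrightarrow> (f ^^ n) y = y"
    and x: "x \<in> S" "f x = x" "(f has_derivative id) (at x)"
    and y: "y \<in> S"
  shows "f y = y"
proof -
  obtain f' where f': "\<And>y. y \<in> S \<Longrightarrow> (f has_derivative blinfun_apply (f' y)) (at y)"
    and cf': "continuous_on S f'"
    using C1_on_open_derivative[OF f(1) S(1)] by blast
  have cf: "continuous_on S f"
    using f' by (meson continuous_at_imp_continuous_on has_derivative_continuous)
  define Z where "Z = {z \<in> S. f z = z \<and> f' z = id_blinfun}"
  have der_id: "(f has_derivative id) (at z)" if "z \<in> Z" for z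
    using f'[of z] that by (simp add: Z_def id_blinfun.rep_eq id_def)
  have "open Z"
  proof (subst open_subopen, rule ballI)
    fix z assume z: "z \<in> Z"
    then have "\<forall>\<^sub>F y in nhds z. f y = y"
      using finite_order_C1_locally_id[OF S(1) f n _ _ der_id[OF z]] by (simp add: Z_def)
    moreover have "\<forall>\<^sub>F y in nhds z. y \<in> S"
      using z S(1) by (intro eventually_nhds_in_open) (auto simp: Z_def)
    ultimately have "\<forall>\<^sub>F y in nhds z. y \<in> S \<and> f y = y" by eventually_elim simp
    then obtain U where U: "open U" "z \<in> U" "\<forall>y\<in>U. y \<in> S \<and> f y = y"
      unfolding eventually_nhds by blast
    have "f' w = id_blinfun" if "w \<in> U" for w
    proof -
      have "(f has_derivative (\<lambda>y. y)) (at w)"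
        by (rule has_derivative_transform_within_open[of "\<lambda>y. y" _ _ _ U])
          (use U that in \<open>auto intro: has_derivative_ident\<close>)
      with f'[of w] U that show ?thesis
        by (intro blinfun_eqI) (metis has_derivative_unique id_blinfun.rep_eq)
    qed
    then show "\<exists>T. open T \<and> z \<in> T \<and> T \<subseteq> Z" using U by (auto simp: Z_def intro!: exI[of _ U])
  qed
  moreover have "closedin (top_of_set S) Z"
  proof -
    have "closedin (top_of_set S) {z \<in> S. f z - z = 0}"
      by (intro continuous_closedin_preimage_constant continuous_intros cf)
    moreover have "closedin (top_of_set S) {z \<in> S. f' z = id_blinfun}"
      by (intro continuous_closedin_preimage_constant cf')
    moreover have "Z = {z \<in> S. f z - z = 0} \<inter> {z \<in> S. f' z = id_blinfun}" by (auto simp: Z_def)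
    ultimately show ?thesis by auto
  qed
  moreover have "openin (top_of_set S) Z"
    using \<open>open Z\<close> by (rule open_subset[rotated]) (auto simp: Z_def)
  moreover have "x \<in> Z"
    using x has_derivative_unique[OF f'[OF x(1)] x(3)]
    by (auto simp: Z_def id_blinfun.rep_eq intro: blinfun_eqI)
  ultimately have "Z = S" using S(2) unfolding connected_clopen by blast
  then show ?thesis using y by (auto simp: Z_def)
qed

section \<open>Homogeneous extension from the sphere\<close>

text \<open>
  The extension that is positively homogeneous of degree 1.  As \<open>sgn 0 = 0\<close> in a normed space, the
  value at the origin is 0 for every \<open>g\<close>, and the composition law holds there too.
\<close>

definition cone_ext :: "('a::real_normed_vector \<Rightarrow> 'a) \<Rightarrow> 'a \<Rightarrow> 'a"
  where "cone_ext g y = norm y *\<^sub>R g (sgn y)"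

lemma cone_ext_sphere: "y \<in> sphere 0 1 \<Longrightarrow> cone_ext g y = g y"
  by (simp add: cone_ext_def sgn_div_norm)

lemma norm_cone_ext:
  assumes "g ` sphere 0 1 \<subseteq> sphere 0 1" shows "norm (cone_ext g y) = norm y"
proof (cases "y = 0")
  case False
  then have "sgn y \<in> sphere 0 1" by (simp add: norm_sgn)
  then have "g (sgn y) \<in> sphere 0 1" using assms by blast
  then show ?thesis by (simp add: cone_ext_def)
qed (simp add: cone_ext_def)

lemma cone_ext_compose:
  assumes g: "g ` sphere 0 1 \<subseteq> sphere 0 1"
  shows "cone_ext (compose (sphere 0 1) f g) y = cone_ext f (cone_ext g y)"
proof (cases "y = 0")
  case False
  then have s: "sgn y \<in> sphere 0 1" by (simp add: norm_sgn)
  then have "g (sgn y) \<in> sphere 0 1" using g by blast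
  then have "sgn (cone_ext g y) = g (sgn y)"
    using False by (simp add: cone_ext_def sgn_scaleR sgn_div_norm)
  then show ?thesis using s norm_cone_ext[OF g, of y] by (simp add: cone_ext_def compose_eq)
qed (simp add: cone_ext_def)

lemma cone_ext_ident: "cone_ext (restrict (\<lambda>x. x) (sphere 0 1)) y = y"
proof (cases "y = 0")
  case False
  then have "sgn y \<in> sphere 0 1" by (simp add: norm_sgn)
  then show ?thesis using False by (simp add: cone_ext_def) (simp add: sgn_div_norm)
qed (simp add: cone_ext_def)

lemma C1_on_cone_ext:
  fixes g :: "'a::euclidean_space \<Rightarrow> 'a"
  assumes "C1_on (sphere 0 1) g" shows "C1_on (-{0}) (cone_ext g)"
  unfolding cone_ext_def
  by (intro C1_on_scaleR C1_on_norm C1_on_compose[OF C1_on_sgn assms]) (auto simp: norm_sgn split: if_splits)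

section \<open>Finite order elements of \<open>SL(2,R)\<close>\<close>

text \<open>
  Averaging the inner product over the powers of \<open>A\<close> gives an inner product \<open>E\<close> that \<open>A\<close> preserves.
  The quadratic relation, which is Cayley-Hamilton for determinant 1, then forces
  \<open>2 E (A v) v = t E v v\<close>, so that the squared \<open>E\<close>-length of \<open>A v - (t/2) v\<close> is \<open>(1 - t\<^sup>2/4) E v v\<close>.
  If \<open>t\<^sup>2 \<ge> 4\<close>, this length has to vanish.
\<close>

lemma finite_order_quadratic:
  fixes A :: "'a::real_inner \<Rightarrow> 'a"
  assumes lin: "linear A" and n: "n > 0" "(A ^^ n) = id"
    and quad: "\<And>v. A (A v) = t *\<^sub>R A v - v"
  shows "t\<^sup>2 < 4 \<or> (\<forall>v. A v = (t/2) *\<^sub>R v)"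
proof -
  define E where "E u v = (\<Sum>k<n. (A ^^ k) u \<bullet> (A ^^ k) v)" for u v
  have linpow: "linear (A ^^ k)" for k
    by (induction k) (simp_all add: linear_iff linear_add[OF lin] linear_cmul[OF lin])
  have E_add: "E (u + u') v = E u v + E u' v" and E_scale: "E (c *\<^sub>R u) v = c * E u v"
    and E_sym: "E u v = E v u" for u u' v c
    by (simp_all add: E_def linear_add[OF linpow] linear_cmul[OF linpow] inner_add_left
        sum.distrib sum_distrib_left inner_commute[of "(A ^^ _) v" "(A ^^ _) u"])
  have E_diff: "E (u - u') v = E u v - E u' v" for u u' v
    using E_add[of "u - u'" u' v] by simp
  have E_diff2: "E v (u - u') = E v u - E v u'" and E_scale2: "E v (c *\<^sub>R u) = c * E v u" for u u' v c
    using E_diff E_scale E_sym by metis+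
  have E_inv: "E (A u) (A v) = E u v" for u v
  proof -
    have "E (A u) (A v) = (\<Sum>k<n. (A ^^ Suc k) u \<bullet> (A ^^ Suc k) v)"
      unfolding E_def by (simp add: funpow_swap1)
    also have "\<dots> = (\<Sum>k<Suc n. (A ^^ k) u \<bullet> (A ^^ k) v) - u \<bullet> v"
      by (subst sum.lessThan_Suc_shift) simp
    also have "\<dots> = E u v"
      by (simp add: E_def n(2) del: funpow.simps(2))
    finally show ?thesis .
  qed
  have E_pos: "v \<bullet> v \<le> E v v" for v
  proof -
    have "(A ^^ 0) v \<bullet> (A ^^ 0) v \<le> E v v"
      unfolding E_def by (rule member_le_sum) (use n in auto)
    then show ?thesis by simp
  qed
  have "A v = (t/2) *\<^sub>R v" if t: "\<not> t\<^sup>2 < 4" for v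
  proof -
    have "E (A v) v = E (A (A v)) (A v)" by (simp add: E_inv)
    also have "\<dots> = t * E v v - E v (A v)" by (simp add: quad E_diff E_scale E_inv)
    finally have *: "2 * E (A v) v = t * E v v" using E_sym[of v "A v"] by simp
    define w where "w = A v - (t/2) *\<^sub>R v"
    have "E w w = E v v - t * E (A v) v + t\<^sup>2/4 * E v v"
      using E_sym[of v "A v"]
      by (simp add: w_def E_diff E_diff2 E_scale E_scale2 E_inv power2_eq_square field_simps)
    also have "\<dots> = (1 - t\<^sup>2/4) * E v v"
      using * by (simp add: algebra_simps power2_eq_square)
    also have "\<dots> \<le> 0"
      using t order_trans[OF inner_ge_zero E_pos[of v]] by (intro mult_nonpos_nonneg) auto
    finally have "w \<bullet> w \<le> 0" using E_pos[of w] by simp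
    then have "w = 0" using inner_gt_zero_iff[of w] by linarith
    then show ?thesis by (simp add: w_def)
  qed
  then show ?thesis by blast
qed

text \<open>
  An element of finite order is elliptic or \<open>\<plusminus>1\<close>: parabolic and hyperbolic elements have infinite order.
\<close>

lemma finite_order_SL2:
  fixes A :: "real^2^2"
  assumes "det A = 1" "n > 0" "((*v) A ^^ n) = id"
  shows "(trace A)\<^sup>2 < 4 \<or> A = (trace A / 2) *\<^sub>R mat 1"
proof -
  have CH: "A *v (A *v v) = trace A *\<^sub>R (A *v v) - v" for v
  proof (simp add: vec_eq_iff forall_2 matrix_vector_mult_def sum_2 trace_def, intro conjI)
    have d: "A$1$1 * A$2$2 - A$1$2 * A$2$1 = 1" using assms(1) by (simp add: det_2)
    show "A $ 1 $ 1 * (A $ 1 $ 1 * v $ 1 + A $ 1 $ 2 * v $ 2) + A $ 1 $ 2 * (A $ 2 $ 1 * v $ 1 + A $ 2 $ 2 * v $ 2) =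
      (A $ 1 $ 1 + A $ 2 $ 2) * (A $ 1 $ 1 * v $ 1 + A $ 1 $ 2 * v $ 2) - v $ 1"
      using d by algebra
    show "A $ 2 $ 1 * (A $ 1 $ 1 * v $ 1 + A $ 1 $ 2 * v $ 2) + A $ 2 $ 2 * (A $ 2 $ 1 * v $ 1 + A $ 2 $ 2 * v $ 2) =
      (A $ 1 $ 1 + A $ 2 $ 2) * (A $ 2 $ 1 * v $ 1 + A $ 2 $ 2 * v $ 2) - v $ 2"
      using d by algebra
  qed
  have "A = c *\<^sub>R mat 1" if "\<forall>v. A *v v = c *\<^sub>R v" for c
    using that by (simp add: matrix_eq scaleR_matrix_vector_assoc[symmetric])
  with finite_order_quadratic[OF matrix_vector_mul_linear assms(2,3) CH] show ?thesis by blast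
qed

text \<open>
  This is the equality case of the reversed Cauchy-Schwarz inequality in Lorentzian 3-space.  With
  \<open>A = (a, b; c, d)\<close> and \<open>C = (e, f; g, h)\<close>, the bound is on the trace of \<open>A C\<^sup>-\<^sup>1\<close>.  The determinant
  is a Lorentzian form on traceless matrices, and the traceless parts of \<open>A\<close> and \<open>C\<close> are timelike
  of the same squared length \<open>\<delta>\<close>.  The condition on \<open>c\<close> and \<open>g\<close> puts them in the same half of the cone.
\<close>

lemma SL2_eq_if_trace_le:
  fixes a b c d e f g h :: real
  assumes det: "a * d - b * c = 1" "e * h - f * g = 1" and tr: "a + d = e + h" "(a + d)\<^sup>2 < 4"
    and sg: "c * g > 0" and le: "a * h - b * g - c * f + d * e \<le> 2"
  shows "a = e \<and> b = f \<and> c = g \<and> d = h"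
proof -
  define m n \<tau> \<delta> where "m = (a - d)/2" and "n = (e - h)/2" and "\<tau> = (a + d)/2" and "\<delta> = 1 - \<tau>\<^sup>2"
  have v: "a = \<tau> + m" "d = \<tau> - m" "e = \<tau> + n" "h = \<tau> - n"
    using tr(1) by (auto simp: m_def n_def \<tau>_def field_simps)
  have \<delta>: "\<delta> > 0" using tr(2) by (simp add: \<delta>_def \<tau>_def power2_eq_square field_simps)
  have bc: "b * c = - \<delta> - m\<^sup>2" and fg: "f * g = - \<delta> - n\<^sup>2"
    using det unfolding v \<delta>_def by (auto simp: power2_eq_square algebra_simps)
  have "- 2*m*n - b*g - c*f \<le> 2 * \<delta>"
    using le unfolding v \<delta>_def by (simp add: power2_eq_square algebra_simps)
  \<comment> \<open>Multiplying by \<open>c g > 0\<close> turns \<open>b\<close> and \<open>f\<close> into the known products \<open>b c\<close> and \<open>f g\<close>.\<close>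
  then have "(- 2*m*n - b*g - c*f) * (c*g) \<le> 2 * \<delta> * (c*g)"
    using sg by (intro mult_right_mono) auto
  moreover have "(- 2*m*n - b*g - c*f) * (c*g) = - 2*m*n*c*g - (b*c)*g\<^sup>2 - (f*g)*c\<^sup>2"
    by (simp add: power2_eq_square algebra_simps)
  ultimately have "(m*g - n*c)\<^sup>2 + \<delta> * (g - c)\<^sup>2 \<le> 0"
    unfolding bc fg by (simp add: power2_eq_square algebra_simps)
  moreover have "(m*g - n*c)\<^sup>2 \<ge> 0" "\<delta> * (g - c)\<^sup>2 \<ge> 0" using \<delta> by auto
  ultimately have "(m*g - n*c)\<^sup>2 = 0" "\<delta> * (g - c)\<^sup>2 = 0" by linarith+
  then have gc: "g = c" and "m * g = n * c" using \<delta> by auto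
  then have mn: "m = n" using sg by auto
  have "(b - f) * c = 0" using bc fg unfolding gc mn left_diff_distrib by linarith
  then have "b = f" using sg by auto
  with gc mn show ?thesis by (simp add: v)
qed

text \<open>
  The second factor is the lower left entry of \<open>B A B\<^sup>-\<^sup>1\<close>, where \<open>B = (p, q; r, s)\<close>.  As a quadratic form in
  \<open>(r, s)\<close> it has discriminant \<open>(a + d)\<^sup>2 - 4 < 0\<close>, so it is definite, of the sign of its coefficient \<open>c\<close>.  In
  other words, conjugation in \<open>SL(2,\<real>)\<close> does not exchange the two halves of the cone.
\<close>

lemma lower_left_conjugate_sign:
  fixes a b c d p q r s :: real
  assumes det: "a * d - b * c = 1" "p * s - q * r = 1" and tr: "(a + d)\<^sup>2 < 4"
  shows "c * (c * s\<^sup>2 + (a - d) * r * s - b * r\<^sup>2) > 0"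
proof -
  define \<delta> where "\<delta> = 1 - ((a+d)/2)\<^sup>2"
  have \<delta>: "\<delta> > 0" using tr by (simp add: \<delta>_def power2_eq_square field_simps)
  have bc: "b * c = a * d - 1" using det by simp
  have "c * (c * s\<^sup>2 + (a - d) * r * s - b * r\<^sup>2) = (c * s)\<^sup>2 + (a-d)*r*(c * s) - (b*c)*r\<^sup>2"
    by (simp add: power2_eq_square algebra_simps)
  also have "\<dots> = (c * s + (a - d)/2 * r)\<^sup>2 + \<delta> * r\<^sup>2"
    unfolding bc \<delta>_def by (simp add: power2_eq_square field_simps)
  also have "\<dots> > 0"
  proof (cases "r = 0")
    case True
    have "c \<noteq> 0"
    proof
      assume "c = 0"
      then have "(a + d)\<^sup>2 = (a - d)\<^sup>2 + 4" using det by (simp add: power2_eq_square algebra_simps)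
      then show False using tr zero_le_power2[of "a - d"] by linarith
    qed
    moreover have "s \<noteq> 0" using True det by auto
    ultimately show ?thesis using True by simp
  next
    case False
    then show ?thesis using \<delta> by (intro add_nonneg_pos) auto
  qed
  finally show ?thesis .
qed

text \<open>
  The commutator is \<open>A C\<^sup>-\<^sup>1\<close> for the conjugate \<open>C = B A B\<^sup>-\<^sup>1\<close>, which has the trace of \<open>A\<close> and lies in the same
  half of the cone.  So the trace bound gives \<open>A = C\<close>.
\<close>

lemma SL2_commute_if_commutator_trace_le:
  fixes A B A' B' :: "real^2^2"
  assumes dA: "det A = 1" and dB: "det B = 1" and A': "A ** A' = mat 1" and B': "B ** B' = mat 1"
    and trA: "(trace A)\<^sup>2 < 4" and tr: "trace (A ** B ** A' ** B') \<le> 2"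
  shows "A ** B = B ** A"
proof -
  \<comment> \<open>An inverse of a matrix of determinant 1 is its adjugate.\<close>
  have adj: "X' $ 1 $ 1 = X $ 2 $ 2 \<and> X' $ 1 $ 2 = - X $ 1 $ 2 \<and> X' $ 2 $ 1 = - X $ 2 $ 1 \<and> X' $ 2 $ 2 = X $ 1 $ 1"
    if "det X = 1" "X ** X' = mat 1" for X X' :: "real^2^2"
  proof -
    have d: "X$1$1 * X$2$2 - X$1$2 * X$2$1 = 1" using that(1) by (simp add: det_2)
    have e: "X$1$1 * X'$1$1 + X$1$2 * X'$2$1 = 1" "X$1$1 * X'$1$2 + X$1$2 * X'$2$2 = 0"
      "X$2$1 * X'$1$1 + X$2$2 * X'$2$1 = 0" "X$2$1 * X'$1$2 + X$2$2 * X'$2$2 = 1"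
      using that(2) by (simp_all add: vec_eq_iff forall_2 matrix_matrix_mult_def sum_2 mat_def)
    show ?thesis by (intro conjI; use d e in algebra)
  qed
  obtain a b c d where A: "A$1$1 = a" "A$1$2 = b" "A$2$1 = c" "A$2$2 = d" by blast
  obtain p q r s where B: "B$1$1 = p" "B$1$2 = q" "B$2$1 = r" "B$2$2 = s" by blast
  note A'_entries = adj[OF dA A', unfolded A] and B'_entries = adj[OF dB B', unfolded B]
  have d: "a * d - b * c = 1" "p * s - q * r = 1"
    using dA dB by (simp_all add: det_2 A B)
  have trA': "(a + d)\<^sup>2 < 4" using trA by (simp add: trace_def sum_2 A)
  define C where "C = B ** A ** B'"
  have C: "C$1$1 = (p*a+q*c)* s - (p*b+q*d)*r" "C$1$2 = (p*b+q*d)*p - (p*a+q*c)*q"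
    "C$2$1 = (r*a+s *c)* s - (r*b+s *d)*r" "C$2$2 = (r*b+s *d)*p - (r*a+s *c)*q"
    by (simp_all add: C_def matrix_matrix_mult_def sum_2 A B B'_entries algebra_simps)
  have "det C = 1"
    using dA dB B' by (simp add: C_def det_mul) (metis det_I det_mul mult_1)
  then have "C$1$1 * C$2$2 - C$1$2 * C$2$1 = 1" by (simp add: det_2)
  moreover have "a + d = C$1$1 + C$2$2"
  proof -
    have "C$1$1 + C$2$2 = (a + d) * (p * s - q * r)" unfolding C by (simp add: algebra_simps)
    then show ?thesis using d by simp
  qed
  moreover have "c * C$2$1 > 0"
    using lower_left_conjugate_sign[OF d trA'] unfolding C by (simp add: algebra_simps power2_eq_square)
  moreover have "a * C$2$2 - b * C$2$1 - c * C$1$2 + d * C$1$1 \<le> 2"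
    using tr unfolding C
    by (simp add: trace_def matrix_matrix_mult_def sum_2 A B A'_entries B'_entries algebra_simps)
  ultimately have "A = C"
    using SL2_eq_if_trace_le[OF d(1) _ _ trA', of "C$1$1" "C$2$2" "C$1$2" "C$2$1"]
    by (simp add: vec_eq_iff forall_2 A)
  moreover have "B' ** B = mat 1" using B' matrix_left_right_inverse by blast
  ultimately show ?thesis by (metis C_def matrix_mul_assoc matrix_mul_rid)
qed

lemma SL2_finite_order_commute:
  fixes A B A' B' :: "real^2^2"
  assumes dA: "det A = 1" and dB: "det B = 1" and A': "A ** A' = mat 1" and B': "B ** B' = mat 1"
    and "m > 0" "((*v) A ^^ m) = id"
    and "n > 0" "((*v) (A ** B ** A' ** B') ^^ n) = id"
  shows "A ** B = B ** A"
proof -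
  let ?C = "A ** B ** A' ** B'"
  consider "(trace A)\<^sup>2 < 4" | c where "A = c *\<^sub>R mat 1"
    using finite_order_SL2[OF dA assms(5,6)] by blast
  then show ?thesis
  proof cases
    case 1
    have "det A' = 1" "det B' = 1" using dA dB A' B' by (metis det_I det_mul mult_1)+
    then have "det ?C = 1" by (simp add: det_mul dA dB)
    then have "(trace ?C)\<^sup>2 < 4 \<or> ?C = (trace ?C / 2) *\<^sub>R mat 1"
      by (rule finite_order_SL2) fact+
    then have "(trace ?C)\<^sup>2 \<le> 2\<^sup>2"
    proof
      assume "?C = (trace ?C / 2) *\<^sub>R mat 1"
      then have "det ?C = det ((trace ?C / 2) *\<^sub>R mat 1 :: real^2^2)" by (rule arg_cong)
      also have "\<dots> = (trace ?C / 2)\<^sup>2" by (simp add: det_2 mat_def power2_eq_square)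
      finally have "det ?C = (trace ?C / 2)\<^sup>2" .
      then show "(trace ?C)\<^sup>2 \<le> 2\<^sup>2" using \<open>det ?C = 1\<close> by (simp add: power2_eq_square)
    qed simp
    then have "trace ?C \<le> 2" by (rule power2_le_imp_le) simp
    then show ?thesis using SL2_commute_if_commutator_trace_le[OF dA dB A' B' 1] by blast
  next
    case 2
    then show ?thesis by (simp add: vec_eq_iff forall_2 matrix_matrix_mult_def sum_2 mat_def)
  qed
qed

section \<open>Subgroups of finite index\<close>

text \<open>
  Finite index of \<open>H\<close> in \<open>K\<close> is expressed by a finite set \<open>T\<close> that meets every left coset.  It is obtained
  from an invariant \<open>c\<close> with finitely many values that separates the cosets, such as the position in
  a finite orbit or the sign of a determinant.
\<close>

lemma (in group) finite_transversal:
  assumes K: "K \<subseteq> carrier G" and fin: "finite (c ` K)"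
    and c: "\<And>g h. g \<in> K \<Longrightarrow> h \<in> K \<Longrightarrow> c g = c h \<Longrightarrow> inv g \<otimes> h \<in> H"
  obtains T where "finite T" "T \<subseteq> K" "\<And>g. g \<in> K \<Longrightarrow> \<exists>t\<in>T. inv t \<otimes> g \<in> H"
proof
  let ?T = "inv_into K c ` c ` K"
  show "finite ?T" using fin by blast
  show "?T \<subseteq> K" by (auto intro: inv_into_into)
  show "\<exists>t\<in>?T. inv t \<otimes> g \<in> H" if "g \<in> K" for g
    using that by (auto intro!: bexI c inv_into_into f_inv_into_f)
qed

lemma (in group) finite_if_finite_index:
  assumes K: "K \<subseteq> carrier G" and T: "finite T" "T \<subseteq> K"
    and TH: "\<And>g. g \<in> K \<Longrightarrow> \<exists>t\<in>T. inv t \<otimes> g \<in> H" and fin: "finite H"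
  shows "finite K"
proof (rule finite_subset)
  show "K \<subseteq> (\<lambda>(t, h). t \<otimes> h) ` (T \<times> H)"
  proof
    fix g assume g: "g \<in> K"
    then obtain t where t: "t \<in> T" "inv t \<otimes> g \<in> H" using TH by blast
    then have "g = t \<otimes> (inv t \<otimes> g)"
      using g K T by (simp add: m_assoc[symmetric] subset_iff)
    with t show "g \<in> (\<lambda>(t, h). t \<otimes> h) ` (T \<times> H)" by (auto intro!: image_eqI)
  qed
  show "finite ((\<lambda>(t, h). t \<otimes> h) ` (T \<times> H))" using T fin by simp
qed

text \<open>
  Schreier's lemma.  Let \<open>rep g\<close> be the representative of the coset of \<open>g\<close>.  The elements
  \<open>rep(s y)\<^sup>-\<^sup>1 s y\<close> of \<open>H\<close>, for \<open>s\<close> a generator and \<open>y\<close> a representative, allow a generator to be moved past a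
  representative.  So the products of a representative and an element of \<open>generate G B\<close> are closed under
  left multiplication by \<open>s\<close>, and they exhaust the group.
\<close>

lemma (in group) schreier:
  assumes A: "finite A" "A \<subseteq> carrier G" and H: "subgroup H G" "H \<subseteq> generate G A"
    and T: "finite T" "T \<subseteq> generate G A"
    and TH: "\<And>g. g \<in> generate G A \<Longrightarrow> \<exists>t\<in>T. inv t \<otimes> g \<in> H"
  obtains B where "finite B" "B \<subseteq> H" "generate G B = H"
proof -
  let ?K = "generate G A"
  have Kc: "?K \<subseteq> carrier G" by (rule generate_incl[OF A(2)])
  obtain rep where rep: "\<And>g. g \<in> ?K \<Longrightarrow> rep g \<in> T" "\<And>g. g \<in> ?K \<Longrightarrow> inv (rep g) \<otimes> g \<in> H"
    using TH by metis
  define S where "S = A \<union> (\<lambda>a. inv a) ` A"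
  have S: "S \<subseteq> ?K" "finite S"
    using A by (auto simp: S_def intro: generate.incl generate.inv)
  define T' where "T' = insert \<one> T"
  have T': "T' \<subseteq> ?K" "finite T'" using T by (auto simp: T'_def generate.one)
  \<comment> \<open>\<open>T\<close> may meet \<open>H\<close> in several elements, none of which need be \<open>\<one>\<close>; adding these elements to the
    generators makes the last step below work.\<close>
  define B where "B = (\<lambda>(s, y). inv (rep (s \<otimes> y)) \<otimes> (s \<otimes> y)) ` (S \<times> T') \<union> (H \<inter> T')"
  have finB: "finite B" using S T' by (simp add: B_def)
  have BH: "B \<subseteq> H"
    unfolding B_def using S T' rep(2) by (auto intro!: rep(2) generate.eng)
  have Hc: "H \<subseteq> carrier G" using H(1) by (rule subgroup.subset)
  have gBc: "generate G B \<subseteq> carrier G" using BH Hc by (intro generate_incl) auto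
  define W where "W = {y \<otimes> b | y b. y \<in> T' \<and> b \<in> generate G B}"
  have Wc: "W \<subseteq> carrier G" using T' Kc gBc by (auto simp: W_def subset_iff)
  have step: "s \<otimes> w \<in> W" if s: "s \<in> S" and w: "w \<in> W" for s w
  proof -
    obtain y b where w: "w = y \<otimes> b" "y \<in> T'" "b \<in> generate G B" using w by (auto simp: W_def)
    have sy: "s \<otimes> y \<in> ?K" using s w S T' by (auto intro: generate.eng)
    have c: "s \<in> carrier G" "y \<in> carrier G" "b \<in> carrier G" "rep (s \<otimes> y) \<in> carrier G"
      using s S Kc w T' gBc rep(1)[OF sy] T by auto
    then have "s \<otimes> w = rep (s \<otimes> y) \<otimes> ((inv (rep (s \<otimes> y)) \<otimes> (s \<otimes> y)) \<otimes> b)"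
      by (metis inv_closed l_one m_assoc m_closed r_inv w(1))
    moreover have "(inv (rep (s \<otimes> y)) \<otimes> (s \<otimes> y)) \<otimes> b \<in> generate G B"
      using s w by (intro generate.eng[OF generate.incl[of _ B]]) (auto simp: B_def)
    moreover have "rep (s \<otimes> y) \<in> T'" using rep(1)[OF sy] by (simp add: T'_def)
    ultimately show ?thesis unfolding W_def by blast
  qed
  have KW: "g \<otimes> w \<in> W" if "g \<in> ?K" "w \<in> W" for g w
    using that
  proof (induction arbitrary: w rule: generate.induct)
    case one then show ?case using Wc by auto
  next
    case (incl h) then show ?case by (intro step) (auto simp: S_def)
  next
    case (inv h) then show ?case by (intro step) (auto simp: S_def)
  next
    case (eng h1 h2)
    then have "h1 \<otimes> h2 \<otimes> w = h1 \<otimes> (h2 \<otimes> w)"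
      using Wc Kc by (intro m_assoc) auto
    then show ?case using eng by simp
  qed
  have "\<one> \<in> W" unfolding W_def
    by (auto intro!: exI[of _ \<one>] simp: T'_def generate.one)
  have "H \<subseteq> generate G B"
  proof
    fix h assume h: "h \<in> H"
    then have "h \<otimes> \<one> \<in> W" using KW H(2) \<open>\<one> \<in> W\<close> by blast
    then obtain y b where yb: "h = y \<otimes> b" "y \<in> T'" "b \<in> generate G B"
      using h Hc by (auto simp: W_def)
    have bH: "b \<in> H" using yb(3) generate_subgroup_incl[OF BH H(1)] by blast
    have "y = h \<otimes> inv b" using yb T' Kc gBc by (subst yb(1)) (auto simp: m_assoc subset_iff)
    then have "y \<in> H" using h bH H(1) by (simp add: subgroup.m_closed subgroup.m_inv_closed)
    then have "y \<in> generate G B" using yb by (intro generate.incl) (auto simp: B_def)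
    then show "h \<in> generate G B" using yb by (auto intro: generate.eng)
  qed
  moreover have "generate G B \<subseteq> H" by (rule generate_subgroup_incl[OF BH H(1)])
  ultimately show thesis using that finB BH by blast
qed

text \<open>
  Adjoining a generator \<open>a\<close> of order dividing \<open>n\<close> multiplies the number of elements by at most \<open>n\<close>, since
  each element of the larger group is \<open>a\<^sup>i b\<close> with \<open>i < n\<close>.
\<close>

lemma (in group) finite_abelian_periodic:
  assumes "finite B" and H: "subgroup H G" "B \<subseteq> H"
    and per: "\<And>g. g \<in> H \<Longrightarrow> \<exists>n>0. g [^] (n::nat) = \<one>"
    and comm: "\<And>g h. g \<in> H \<Longrightarrow> h \<in> H \<Longrightarrow> g \<otimes> h = h \<otimes> g"
  shows "finite (generate G B)"
  using \<open>finite B\<close> \<open>B \<subseteq> H\<close>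
proof (induction B rule: finite_induct)
  case empty
  then show ?case by (simp add: generate_empty)
next
  case (insert a B)
  have Hc: "H \<subseteq> carrier G" using H(1) by (rule subgroup.subset)
  have gBH: "generate G B \<subseteq> H" using insert by (intro generate_subgroup_incl H) auto
  have aH: "a \<in> H" using insert by simp
  have powH: "a [^] (i::nat) \<in> H" for i
    using aH H(1) by (induction i) (auto simp: subgroup.one_closed subgroup.m_closed)
  obtain n where n: "n > 0" "a [^] (n::nat) = \<one>" using per aH by blast
  have mod: "a [^] i = a [^] (i mod n)" for i :: nat
  proof -
    have "a [^] i = (a [^] n) [^] (i div n) \<otimes> a [^] (i mod n)"
      using aH Hc by (simp add: nat_pow_pow nat_pow_mult subset_iff)
    then show ?thesis using n aH Hc by (auto simp: subset_iff)
  qed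
  define W where "W = {a [^] (i::nat) \<otimes> b | i b. b \<in> generate G B}"
  have Wprod: "u \<otimes> w \<in> W" if uw: "u \<in> W" "w \<in> W" for u w
  proof -
    obtain i b j b' where u: "u = a [^] (i::nat) \<otimes> b" "b \<in> generate G B"
      and w: "w = a [^] (j::nat) \<otimes> b'" "b' \<in> generate G B" using uw by (auto simp: W_def)
    have H': "b \<in> H" "b' \<in> H" using u w gBH by auto
    then have c: "b \<in> carrier G" "b' \<in> carrier G" "a \<in> carrier G" using Hc aH by auto
    have "u \<otimes> w = a [^] i \<otimes> (b \<otimes> a [^] j) \<otimes> b'" using c by (simp add: u w m_assoc)
    also have "b \<otimes> a [^] j = a [^] j \<otimes> b" by (rule comm) (use H' powH in auto)
    also have "a [^] i \<otimes> (a [^] j \<otimes> b) \<otimes> b' = a [^] (i + j) \<otimes> (b \<otimes> b')"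
      using c by (simp add: nat_pow_mult[symmetric] m_assoc)
    finally show ?thesis unfolding W_def using u w by (blast intro: generate.eng)
  qed
  have Bc: "B \<subseteq> carrier G" "a \<in> carrier G" using insert Hc by auto
  have BW: "generate G B \<subseteq> W"
  proof
    fix b assume b: "b \<in> generate G B"
    then have "b = a [^] (0::nat) \<otimes> b" using generate_incl[OF Bc(1)] by auto
    then show "b \<in> W" using b unfolding W_def by blast
  qed
  have aW: "a [^] (i::nat) \<in> W" for i
    unfolding W_def using Bc by (intro CollectI exI[of _ i] exI[of _ \<one>]) (auto simp: generate.one)
  have inva: "inv a = a [^] (n - 1)"
  proof (rule inv_equality)
    show "a [^] (n - 1) \<otimes> a = \<one>"
      using n by (metis Suc_pred' nat_pow_Suc)
  qed (use Bc in auto)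
  have "generate G (insert a B) \<subseteq> W"
  proof
    fix g assume "g \<in> generate G (insert a B)"
    then show "g \<in> W"
    proof (induction rule: generate.induct)
      case one then show ?case using BW generate.one by blast
    next
      case (incl h) then show ?case using aW[of 1] Bc BW generate.incl[of h B G] by auto
    next
      case (inv h) then show ?case using aW inva BW generate.inv[of h B G] by auto
    next
      case eng then show ?case using Wprod by blast
    qed
  qed
  moreover have "W \<subseteq> (\<lambda>(i, b). a [^] i \<otimes> b) ` ({..<n} \<times> generate G B)"
  proof
    fix w assume "w \<in> W"
    then obtain i b where w: "w = a [^] (i::nat) \<otimes> b" "b \<in> generate G B" by (auto simp: W_def)
    then have "w = (\<lambda>(i, b). a [^] i \<otimes> b) (i mod n, b)" using mod[of i] by simp
    moreover have "(i mod n, b) \<in> {..<n} \<times> generate G B" using w n(1) by simp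
    ultimately show "w \<in> (\<lambda>(i, b). a [^] i \<otimes> b) ` ({..<n} \<times> generate G B)"
      by (rule image_eqI)
  qed
  then have "finite W" by (rule finite_subset) (use insert in simp)
  ultimately show ?case by (blast intro: finite_subset)
qed

section \<open>The derivative at a fixed point\<close>

lemma Diff1_carrier: "g \<in> carrier (Diff1 S) \<longleftrightarrow> g \<in> C1_diffeos S"
  by (simp add: Diff1_def)

lemma Diff1_mult: "g \<in> C1_diffeos S \<Longrightarrow> h \<in> C1_diffeos S \<Longrightarrow> g \<otimes>\<^bsub>Diff1 S\<^esub> h = compose S g h"
  by (simp add: Diff1_def BijGroup_def C1_diffeos_def)

lemma Diff1_one: "\<one>\<^bsub>Diff1 S\<^esub> = restrict (\<lambda>x. x) S"
  by (simp add: Diff1_def BijGroup_def)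

lemma C1_diffeos_image: "g \<in> C1_diffeos S \<Longrightarrow> g ` S \<subseteq> S"
  by (auto simp: C1_diffeos_def Bij_def bij_betw_def)

lemma C1_diffeos_C1: "g \<in> C1_diffeos S \<Longrightarrow> C1_on S g"
  by (simp add: C1_diffeos_def)

lemma cone_ext_mult:
  assumes "g \<in> C1_diffeos (sphere 0 1)" "h \<in> C1_diffeos (sphere 0 1)"
  shows "cone_ext (g \<otimes>\<^bsub>Diff1 (sphere 0 1)\<^esub> h) = cone_ext g \<circ> cone_ext h"
  using assms by (simp add: fun_eq_iff Diff1_mult cone_ext_compose C1_diffeos_image)

lemma cone_ext_one: "cone_ext \<one>\<^bsub>Diff1 (sphere 0 1)\<^esub> = id"
  by (simp add: fun_eq_iff Diff1_one cone_ext_ident)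

lemma cone_ext_pow:
  assumes "g \<in> C1_diffeos (sphere 0 1)"
  shows "cone_ext (g [^]\<^bsub>Diff1 (sphere 0 1)\<^esub> n) = cone_ext g ^^ (n::nat)"
proof (induction n)
  case (Suc n)
  interpret group "Diff1 (sphere 0 1 :: 'a set)" by (rule group_Diff1)
  have "g [^]\<^bsub>Diff1 (sphere 0 1)\<^esub> n \<in> C1_diffeos (sphere 0 1)"
    using assms nat_pow_closed unfolding Diff1_carrier by blast
  then show ?case using Suc assms by (simp add: cone_ext_mult funpow_Suc_right del: funpow.simps)
qed (simp add: cone_ext_one)

text \<open>
  A point \<open>x\<close> of the sphere with a positively oriented orthonormal basis \<open>u, v\<close> of its tangent plane.
\<close>

locale tangent_frame =
  fixes x u v :: "real^3"
  assumes norm_x: "norm x = 1" and norm_u: "norm u = 1" and xu: "x \<bullet> u = 0"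
    and v_def: "v = cross3 x u"
begin

lemma x_S2: "x \<in> S2" and x_nonzero: "x \<in> -{0}"
  using norm_x by auto

lemma frame_inner:
  "x \<bullet> x = 1" "u \<bullet> u = 1" "v \<bullet> v = 1" "u \<bullet> x = 0" "x \<bullet> v = 0" "v \<bullet> x = 0" "u \<bullet> v = 0" "v \<bullet> u = 0"
proof -
  show xx: "x \<bullet> x = 1" and uu: "u \<bullet> u = 1" using norm_x norm_u by (simp_all add: norm_eq_1)
  show "u \<bullet> x = 0" using xu by (simp add: inner_commute)
  show "x \<bullet> v = 0" "v \<bullet> x = 0" "u \<bullet> v = 0" "v \<bullet> u = 0"
    by (simp_all add: v_def dot_cross_self)
  have "(norm v)\<^sup>2 + (x \<bullet> u)\<^sup>2 = (norm x * norm u)\<^sup>2" unfolding v_def by (rule norm_cross_dot)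
  then show "v \<bullet> v = 1" by (simp add: norm_x norm_u xu power2_norm_eq_inner)
qed

lemma cross_u_v: "cross3 u v = x"
  by (simp add: v_def Lagrange frame_inner)

lemma norm_v: "norm v = 1"
  by (simp add: norm_eq_1 frame_inner)

lemma frame_expand: "w = (x \<bullet> w) *\<^sub>R x + (u \<bullet> w) *\<^sub>R u + (v \<bullet> w) *\<^sub>R v"
proof -
  define d where "d = w - ((x \<bullet> w) *\<^sub>R x + (u \<bullet> w) *\<^sub>R u + (v \<bullet> w) *\<^sub>R v)"
  have d: "x \<bullet> d = 0" "u \<bullet> d = 0" "v \<bullet> d = 0"
    by (simp_all add: d_def inner_diff_right inner_add_right frame_inner xu)
  have "cross3 d v = 0"
    using d by (simp add: v_def Lagrange inner_commute)
  moreover have "v \<noteq> 0" using norm_v by auto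
  ultimately have "d = 0"
    using norm_and_cross_eq_0[of d v] d(3) by (simp add: inner_commute)
  then show ?thesis by (simp add: d_def)
qed

definition fixers :: "(real^3 \<Rightarrow> real^3) set"
  where "fixers = {g \<in> C1_diffeos S2. g x = x}"

definition cone_deriv :: "(real^3 \<Rightarrow> real^3) \<Rightarrow> real^3 \<Rightarrow> real^3"
  where "cone_deriv g = frechet_derivative (cone_ext g) (at x)"

definition tangent_matrix :: "(real^3 \<Rightarrow> real^3) \<Rightarrow> real^2^2"
  where "tangent_matrix g = vector [vector [u \<bullet> cone_deriv g u, u \<bullet> cone_deriv g v], vector [v \<bullet> cone_deriv g u, v \<bullet> cone_deriv g v]]"

lemma fixersD: "g \<in> fixers \<Longrightarrow> g \<in> C1_diffeos S2" "g \<in> fixers \<Longrightarrow> g x = x"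
  by (auto simp: fixers_def)

lemma cone_ext_x: "g \<in> fixers \<Longrightarrow> cone_ext g x = x"
  using x_S2 by (simp add: cone_ext_sphere fixersD)

lemma has_derivative_cone_ext:
  assumes g: "g \<in> fixers" shows "(cone_ext g has_derivative cone_deriv g) (at x)"
proof -
  have "C1_on (-{0}) (cone_ext g)"
    using g by (intro C1_on_cone_ext C1_diffeos_C1 fixersD)
  then have "\<exists>D. (cone_ext g has_derivative D) (at x)"
    by (rule C1_on_open_derivative) (use x_nonzero in auto)
  then show ?thesis
    unfolding cone_deriv_def using frechet_derivative_works differentiable_def by blast
qed

lemma linear_cone_deriv: "g \<in> fixers \<Longrightarrow> linear (cone_deriv g)"
  using has_derivative_cone_ext has_derivative_linear by blast

lemma fixers_mult:
  assumes "g \<in> fixers" "h \<in> fixers" shows "g \<otimes>\<^bsub>Diff1 S2\<^esub> h \<in> fixers"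
proof -
  interpret group "Diff1 S2" by (rule group_Diff1)
  have "g \<otimes>\<^bsub>Diff1 S2\<^esub> h \<in> C1_diffeos S2"
    using assms m_closed[of g h] by (simp add: Diff1_carrier fixersD)
  then show ?thesis
    using assms x_S2 by (simp add: fixers_def Diff1_mult compose_eq)
qed

lemma fixers_inv:
  assumes "g \<in> fixers" shows "inv\<^bsub>Diff1 S2\<^esub> g \<in> fixers"
proof -
  interpret group "Diff1 S2" by (rule group_Diff1)
  have g: "g \<in> carrier (Diff1 S2)" using assms by (simp add: Diff1_carrier fixersD)
  then have i: "inv\<^bsub>Diff1 S2\<^esub> g \<in> C1_diffeos S2" using inv_closed Diff1_carrier by blast
  have "(inv\<^bsub>Diff1 S2\<^esub> g \<otimes>\<^bsub>Diff1 S2\<^esub> g) x = x"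
    using g x_S2 by (simp add: Diff1_one)
  then show ?thesis
    using i assms x_S2 by (simp add: fixers_def Diff1_mult compose_eq)
qed

lemma fixers_one: "\<one>\<^bsub>Diff1 S2\<^esub> \<in> fixers"
proof -
  interpret group "Diff1 S2" by (rule group_Diff1)
  have "\<one>\<^bsub>Diff1 S2\<^esub> \<in> C1_diffeos S2" using one_closed unfolding Diff1_carrier .
  then show ?thesis using x_S2 by (simp add: fixers_def Diff1_one)
qed

lemma fixers_pow: "g \<in> fixers \<Longrightarrow> g [^]\<^bsub>Diff1 S2\<^esub> (n::nat) \<in> fixers"
  by (induction n) (simp_all add: fixers_one fixers_mult)

lemma cone_deriv_mult:
  assumes g: "g \<in> fixers" and h: "h \<in> fixers"
  shows "cone_deriv (g \<otimes>\<^bsub>Diff1 S2\<^esub> h) w = cone_deriv g (cone_deriv h w)"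
proof -
  have "((\<lambda>y. cone_ext g (cone_ext h y)) has_derivative (\<lambda>w. cone_deriv g (cone_deriv h w))) (at x)"
    by (rule has_derivative_compose[OF has_derivative_cone_ext[OF h]])
      (use has_derivative_cone_ext[OF g] cone_ext_x[OF h] in simp)
  then have "(cone_ext (g \<otimes>\<^bsub>Diff1 S2\<^esub> h) has_derivative (\<lambda>w. cone_deriv g (cone_deriv h w))) (at x)"
    using g h by (simp add: cone_ext_mult fixersD o_def)
  from frechet_derivative_at[OF this] show ?thesis unfolding cone_deriv_def by metis
qed

lemma cone_deriv_one: "cone_deriv \<one>\<^bsub>Diff1 S2\<^esub> w = w"
  unfolding cone_deriv_def cone_ext_one by (simp add: frechet_derivative_id)

text \<open>
  The extension fixes every point of the ray through \<open>x\<close>.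
\<close>

lemma cone_deriv_radial:
  assumes g: "g \<in> fixers" shows "cone_deriv g x = x"
proof -
  have 1: "((\<lambda>t. cone_ext g (t *\<^sub>R x)) has_derivative (\<lambda>s. cone_deriv g (s *\<^sub>R x))) (at (1::real))"
    by (rule has_derivative_compose[of "\<lambda>t. t *\<^sub>R x"])
      (use has_derivative_cone_ext[OF g] in \<open>auto intro!: derivative_eq_intros\<close>)
  have 2: "((\<lambda>t. cone_ext g (t *\<^sub>R x)) has_derivative (\<lambda>s. s *\<^sub>R x)) (at (1::real))"
  proof (rule has_derivative_transform_within_open[of _ _ _ _ "{0<..}"])
    show "((\<lambda>t. t *\<^sub>R x) has_derivative (\<lambda>s. s *\<^sub>R x)) (at (1::real))"
      by (auto intro!: derivative_eq_intros)
    show "t *\<^sub>R x = cone_ext g (t *\<^sub>R x)" if "t \<in> {0<..}" for t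
      using that norm_x fixersD(2)[OF g] by (simp add: cone_ext_def sgn_scaleR sgn_div_norm)
  qed auto
  show ?thesis using has_derivative_unique[OF 1 2] by (metis scaleR_one)
qed

text \<open>
  The extension preserves the norm; differentiating \<open>|g y|\<^sup>2 = |y|\<^sup>2\<close> at \<open>y = x\<close> gives the claim.  It implies that the
  derivative preserves the tangent plane.
\<close>

lemma cone_deriv_inner_x:
  assumes g: "g \<in> fixers" shows "x \<bullet> cone_deriv g w = x \<bullet> w"
proof -
  have "(\<lambda>y. cone_ext g y \<bullet> cone_ext g y) = (\<lambda>y. y \<bullet> y)"
    using norm_cone_ext[OF C1_diffeos_image[OF fixersD(1)[OF g]]] by (simp add: fun_eq_iff dot_square_norm)
  moreover have "((\<lambda>y. cone_ext g y \<bullet> cone_ext g y) has_derivative (\<lambda>w. cone_ext g x \<bullet> cone_deriv g w + cone_deriv g w \<bullet> cone_ext g x)) (at x)"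
    by (intro has_derivative_inner has_derivative_cone_ext g)
  ultimately have 1: "((\<lambda>y. y \<bullet> y) has_derivative (\<lambda>w. cone_ext g x \<bullet> cone_deriv g w + cone_deriv g w \<bullet> cone_ext g x)) (at x)"
    by simp
  have 2: "((\<lambda>y. y \<bullet> y) has_derivative (\<lambda>w. x \<bullet> w + w \<bullet> x)) (at x)"
    by (intro has_derivative_inner has_derivative_ident)
  have "cone_ext g x \<bullet> cone_deriv g w + cone_deriv g w \<bullet> cone_ext g x = x \<bullet> w + w \<bullet> x"
    using has_derivative_unique[OF 1 2] by metis
  then show ?thesis by (simp add: cone_ext_x[OF g] inner_commute)
qed

lemma cone_deriv_frame:
  assumes g: "g \<in> fixers"
  shows "cone_deriv g u = tangent_matrix g $1$1 *\<^sub>R u + tangent_matrix g $2$1 *\<^sub>R v" "cone_deriv g v = tangent_matrix g $1$2 *\<^sub>R u + tangent_matrix g $2$2 *\<^sub>R v"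
  using frame_expand[of "cone_deriv g u"] frame_expand[of "cone_deriv g v"]
  by (simp_all add: tangent_matrix_def cone_deriv_inner_x[OF g] frame_inner xu)

lemma tangent_matrix_mult:
  assumes g: "g \<in> fixers" and h: "h \<in> fixers"
  shows "tangent_matrix (g \<otimes>\<^bsub>Diff1 S2\<^esub> h) = tangent_matrix g ** tangent_matrix h"
proof -
  note lin = linear_add[OF linear_cone_deriv[OF g]] linear_cmul[OF linear_cone_deriv[OF g]]
  have "tangent_matrix (g \<otimes>\<^bsub>Diff1 S2\<^esub> h) $ i $ j = (tangent_matrix g ** tangent_matrix h) $ i $ j" for i j
    unfolding tangent_matrix_def[of "g \<otimes>\<^bsub>Diff1 S2\<^esub> h"] cone_deriv_mult[OF g h] cone_deriv_frame[OF h] lin cone_deriv_frame[OF g]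
    using exhaust_2[of i] exhaust_2[of j]
    by (auto simp: matrix_matrix_mult_def sum_2 inner_add_right frame_inner)
  then show ?thesis by (simp add: vec_eq_iff)
qed

lemma tangent_matrix_one: "tangent_matrix \<one>\<^bsub>Diff1 S2\<^esub> = mat 1"
  by (simp add: tangent_matrix_def cone_deriv_one frame_inner vec_eq_iff forall_2 mat_def)

lemma tangent_matrix_pow:
  assumes g: "g \<in> fixers"
  shows "(*v) (tangent_matrix (g [^]\<^bsub>Diff1 S2\<^esub> (n::nat))) = ((*v) (tangent_matrix g) ^^ n)"
    and "det (tangent_matrix (g [^]\<^bsub>Diff1 S2\<^esub> n)) = det (tangent_matrix g) ^ n"
proof -
  have "(*v) (tangent_matrix (g [^]\<^bsub>Diff1 S2\<^esub> (n::nat))) = ((*v) (tangent_matrix g) ^^ n) \<and>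
    det (tangent_matrix (g [^]\<^bsub>Diff1 S2\<^esub> n)) = det (tangent_matrix g) ^ n"
  proof (induction n)
    case 0 then show ?case by (simp add: tangent_matrix_one fun_eq_iff)
  next
    case (Suc n)
    then show ?case
      using g fixers_pow[OF g, of n]
      by (auto simp: tangent_matrix_mult funpow_Suc_right det_mul fun_eq_iff matrix_vector_mul_assoc[symmetric] simp del: funpow.simps)
  qed
  then show "(*v) (tangent_matrix (g [^]\<^bsub>Diff1 S2\<^esub> (n::nat))) = ((*v) (tangent_matrix g) ^^ n)"
    and "det (tangent_matrix (g [^]\<^bsub>Diff1 S2\<^esub> n)) = det (tangent_matrix g) ^ n" by auto
qed

text \<open>
  The derivative of the extension fixes \<open>x\<close> in any case, so a trivial action on the tangent plane
  means that this derivative is the identity, and rigidity applies on \<open>-{0}\<close>.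
\<close>

lemma tangent_matrix_faithful:
  assumes g: "g \<in> fixers" and n: "n > 0" "g [^]\<^bsub>Diff1 S2\<^esub> (n::nat) = \<one>\<^bsub>Diff1 S2\<^esub>"
    and trivial: "tangent_matrix g = mat 1"
  shows "g = \<one>\<^bsub>Diff1 S2\<^esub>"
proof -
  have "cone_deriv g w = w" for w
  proof -
    have "cone_deriv g u = u" "cone_deriv g v = v" using cone_deriv_frame[OF g] by (simp_all add: trivial mat_def)
    then show ?thesis
      by (subst (1 2) frame_expand[of w])
        (simp add: linear_add[OF linear_cone_deriv[OF g]] linear_cmul[OF linear_cone_deriv[OF g]] cone_deriv_radial[OF g])
  qed
  then have "cone_deriv g = id" by (simp add: fun_eq_iff)
  then have der: "(cone_ext g has_derivative id) (at x)"
    using has_derivative_cone_ext[OF g] by metis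
  have gC: "g \<in> C1_diffeos S2" using g by (rule fixersD)
  have "cone_ext g y = y" if "y \<in> -{0}" for y
  proof (rule finite_order_C1_rigid[OF _ _ C1_on_cone_ext[OF C1_diffeos_C1[OF gC]] _ n(1) _ x_nonzero cone_ext_x[OF g] der that])
    show "connected (-{0::real^3})" by (rule connected_punctured_universe) simp
    show "cone_ext g ` (-{0}) \<subseteq> -{0}"
      using norm_cone_ext[OF C1_diffeos_image[OF gC]] by (metis ComplI image_subsetI norm_eq_zero singletonD ComplD insertI1)
    show "(cone_ext g ^^ n) y = y" for y
      using cone_ext_pow[OF gC, of n] by (simp add: n(2) cone_ext_one)
  qed auto
  then have "g y = y" if "y \<in> S2" for y
    proof -
    have "y \<in> -{0}" using that by auto
    then show ?thesis using \<open>\<And>y. y \<in> -{0} \<Longrightarrow> cone_ext g y = y\<close> cone_ext_sphere[OF that, of g] by simp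
  qed
  moreover have "g \<in> extensional S2" using gC by (simp add: C1_diffeos_def Bij_def)
  ultimately show ?thesis
    unfolding Diff1_one by (intro extensionalityI[of _ S2]) auto
qed

text \<open>
  A derivative within the sphere is determined on tangent vectors only.  There, it is compared with
  the derivative of the extension along the great circle through \<open>x\<close> in direction \<open>w\<close>.
\<close>

lemma derivative_on_sphere_eq_cone_deriv:
  assumes g: "g \<in> fixers" and E: "(g has_derivative E) (at x within S2)"
    and w: "norm w = 1" "x \<bullet> w = 0"
  shows "E w = cone_deriv g w"
proof -
  define c where "c t = cos t *\<^sub>R x + sin t *\<^sub>R w" for t :: real
  have c0: "c 0 = x" by (simp add: c_def)
  have cS: "c t \<in> S2" for t
  proof -
    have "w \<bullet> w = 1" using w by (simp add: norm_eq_1)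
    then have "c t \<bullet> c t = (cos t)\<^sup>2 + (sin t)\<^sup>2"
      using w(2) by (simp add: c_def inner_add_left inner_add_right frame_inner inner_commute[of w x] power2_eq_square)
    then show ?thesis by (simp add: norm_eq_1)
  qed
  have cd: "(c has_derivative (\<lambda>t. t *\<^sub>R w)) (at 0)"
    unfolding c_def by (auto intro!: derivative_eq_intros)
  have "((\<lambda>t. g (c t)) has_derivative (\<lambda>t. E (t *\<^sub>R w))) (at 0)"
    by (rule has_derivative_in_compose[OF cd]) (use E c0 cS in \<open>auto intro: has_derivative_subset\<close>)
  moreover have "((\<lambda>t. cone_ext g (c t)) has_derivative (\<lambda>t. cone_deriv g (t *\<^sub>R w))) (at 0)"
    by (rule has_derivative_compose[OF cd]) (use has_derivative_cone_ext[OF g] c0 in simp)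
  moreover have "(\<lambda>t. cone_ext g (c t)) = (\<lambda>t. g (c t))"
    using cS by (simp add: cone_ext_sphere)
  ultimately have "(\<lambda>t. E (t *\<^sub>R w)) = (\<lambda>t. cone_deriv g (t *\<^sub>R w))"
    using has_derivative_unique by metis
  then show ?thesis by (metis scaleR_one)
qed

lemma det_tangent_matrix_pos_if_orientation_preserving:
  assumes g: "g \<in> fixers" and o: "orientation_preserving g"
  shows "det (tangent_matrix g) > 0"
proof -
  obtain E where E: "(g has_derivative E) (at x within S2)"
    and pos: "\<And>u v. x \<bullet> u = 0 \<Longrightarrow> x \<bullet> v = 0 \<Longrightarrow> det (vector [x, u, v] :: real^3^3) > 0
        \<Longrightarrow> det (vector [g x, E u, E v] :: real^3^3) > 0"
    using o x_S2 unfolding orientation_preserving_def by metis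
  have "det (vector [x, u, v] :: real^3^3) > 0"
    by (simp add: dot_cross_det[symmetric] cross_u_v frame_inner)
  then have "0 < det (vector [g x, E u, E v] :: real^3^3)"
    using pos xu frame_inner by blast
  also have "\<dots> = x \<bullet> cross3 (cone_deriv g u) (cone_deriv g v)"
    using derivative_on_sphere_eq_cone_deriv[OF g E] norm_u norm_v xu frame_inner fixersD(2)[OF g]
    by (simp add: dot_cross_det)
  also have "\<dots> = det (tangent_matrix g)"
    unfolding cone_deriv_frame[OF g]
    by (simp add: cross_add_left cross_add_right cross_mult_left cross_mult_right cross_u_v
        cross_skew[of v u] frame_inner inner_add_right det_2 algebra_simps)
  finally show ?thesis .
qed

text \<open>
  The determinants are positive and of finite order, hence 1, so the matrices commute.  Therefore the
  commutator of \<open>a\<close> and \<open>b\<close> has trivial matrix, and it is trivial since it has finite order.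
\<close>

theorem periodic_orientation_preserving_commute:
  assumes H: "subgroup H (Diff1 S2)" "H \<subseteq> fixers" and per: "periodic_in (Diff1 S2) H"
    and pos: "\<And>g. g \<in> H \<Longrightarrow> det (tangent_matrix g) > 0" and ab: "a \<in> H" "b \<in> H"
  shows "a \<otimes>\<^bsub>Diff1 S2\<^esub> b = b \<otimes>\<^bsub>Diff1 S2\<^esub> a"
proof -
  interpret group "Diff1 S2" by (rule group_Diff1)
  interpret H: subgroup H "Diff1 S2" by (rule H(1))
  let ?a' = "inv\<^bsub>Diff1 S2\<^esub> a" and ?b' = "inv\<^bsub>Diff1 S2\<^esub> b"
  define c where "c = a \<otimes>\<^bsub>Diff1 S2\<^esub> b \<otimes>\<^bsub>Diff1 S2\<^esub> ?a' \<otimes>\<^bsub>Diff1 S2\<^esub> ?b'"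
  have cH: "c \<in> H" using ab by (simp add: c_def)
  note F = subsetD[OF H(2)]
  have det1: "det (tangent_matrix g) = 1" and ord: "\<exists>n>0. ((*v) (tangent_matrix g) ^^ n) = id" if g: "g \<in> H" for g
  proof -
    obtain n where n: "n > 0" "g [^]\<^bsub>Diff1 S2\<^esub> (n::nat) = \<one>\<^bsub>Diff1 S2\<^esub>"
      using per g unfolding periodic_in_def by blast
    have "det (tangent_matrix g) ^ n = 1 ^ n" using tangent_matrix_pow(2)[OF F[OF g], of n] by (simp add: n(2) tangent_matrix_one)
    then show "det (tangent_matrix g) = 1"
      by (rule power_eq_imp_eq_base) (use pos[OF g] n in auto)
    have "((*v) (tangent_matrix g) ^^ n) = id"
      using tangent_matrix_pow(1)[OF F[OF g], of n] by (simp add: n(2) tangent_matrix_one fun_eq_iff)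
    then show "\<exists>n>0. ((*v) (tangent_matrix g) ^^ n) = id" using n by blast
  qed
  have inv: "tangent_matrix g ** tangent_matrix (inv\<^bsub>Diff1 S2\<^esub> g) = mat 1" if "g \<in> H" for g
    using that by (simp add: tangent_matrix_mult[symmetric] F fixers_inv tangent_matrix_one)
  have tangent_matrix_c: "tangent_matrix c = tangent_matrix a ** tangent_matrix b ** tangent_matrix ?a' ** tangent_matrix ?b'"
    unfolding c_def by (simp add: tangent_matrix_mult F fixers_inv fixers_mult ab)
  obtain m where m: "m > 0" "((*v) (tangent_matrix a) ^^ m) = id" using ord[OF ab(1)] by blast
  obtain n where n: "n > 0" "((*v) (tangent_matrix c) ^^ n) = id" using ord[OF cH] by blast
  have "tangent_matrix a ** tangent_matrix b = tangent_matrix b ** tangent_matrix a"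
    using SL2_finite_order_commute[OF det1[OF ab(1)] det1[OF ab(2)] inv[OF ab(1)] inv[OF ab(2)] m n(1)] n(2)
    unfolding tangent_matrix_c by blast
  then have "tangent_matrix c = tangent_matrix b ** (tangent_matrix a ** tangent_matrix ?a') ** tangent_matrix ?b'"
    by (simp add: tangent_matrix_c matrix_mul_assoc)
  then have "tangent_matrix c = mat 1" by (simp add: inv ab)
  moreover obtain k where "k > 0" "c [^]\<^bsub>Diff1 S2\<^esub> (k::nat) = \<one>\<^bsub>Diff1 S2\<^esub>"
    using per cH unfolding periodic_in_def by blast
  ultimately have "c = \<one>\<^bsub>Diff1 S2\<^esub>" using tangent_matrix_faithful F cH by blast
  then have "a \<otimes>\<^bsub>Diff1 S2\<^esub> b \<otimes>\<^bsub>Diff1 S2\<^esub> inv\<^bsub>Diff1 S2\<^esub> (b \<otimes>\<^bsub>Diff1 S2\<^esub> a) = \<one>\<^bsub>Diff1 S2\<^esub>"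
    using ab by (simp add: c_def inv_mult_group m_assoc)
  then have "inv\<^bsub>Diff1 S2\<^esub> (inv\<^bsub>Diff1 S2\<^esub> (b \<otimes>\<^bsub>Diff1 S2\<^esub> a)) = a \<otimes>\<^bsub>Diff1 S2\<^esub> b"
    by (rule inv_equality) (use ab in auto)
  then show ?thesis using ab by simp
qed

text \<open>
  The subgroup \<open>L\<close> of positive determinant has index at most 2, is abelian, and inherits finite
  generation by Schreier's lemma.
\<close>

theorem finite_periodic_fixing_group:
  assumes K: "subgroup K (Diff1 S2)" "K \<subseteq> fixers" and per: "periodic_in (Diff1 S2) K"
    and B: "finite B" "B \<subseteq> carrier (Diff1 S2)" "generate (Diff1 S2) B = K"
  shows "finite K"
proof -
  interpret group "Diff1 S2" by (rule group_Diff1)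
  interpret K: subgroup K "Diff1 S2" by (rule K(1))
  note F = subsetD[OF K(2)]
  define L where "L = {g \<in> K. det (tangent_matrix g) > 0}"
  have det_inv: "det (tangent_matrix (inv\<^bsub>Diff1 S2\<^esub> g)) * det (tangent_matrix g) = 1" if "g \<in> K" for g
  proof -
    have "tangent_matrix (inv\<^bsub>Diff1 S2\<^esub> g) ** tangent_matrix g = mat 1"
      using tangent_matrix_mult[OF fixers_inv[OF F] F, OF that that] that by (simp add: tangent_matrix_one)
    then show ?thesis by (metis det_mul det_I)
  qed
  have L: "subgroup L (Diff1 S2)"
  proof (rule subgroupI)
    show "L \<subseteq> carrier (Diff1 S2)" using K.subset by (auto simp: L_def)
    have "\<one>\<^bsub>Diff1 S2\<^esub> \<in> L" by (simp add: L_def tangent_matrix_one)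
    then show "L \<noteq> {}" by blast
    show "inv\<^bsub>Diff1 S2\<^esub> g \<in> L" if "g \<in> L" for g
    proof -
      have "det (tangent_matrix (inv\<^bsub>Diff1 S2\<^esub> g)) * det (tangent_matrix g) > 0" "det (tangent_matrix g) > 0"
        using that det_inv[of g] by (simp_all add: L_def)
      then have "det (tangent_matrix (inv\<^bsub>Diff1 S2\<^esub> g)) > 0" by (rule zero_less_mult_pos2)
      then show ?thesis using that by (simp add: L_def)
    qed
    show "g \<otimes>\<^bsub>Diff1 S2\<^esub> h \<in> L" if "g \<in> L" "h \<in> L" for g h
      using that by (simp add: L_def tangent_matrix_mult det_mul F)
  qed
  obtain T where T: "finite T" "T \<subseteq> K" "\<And>g. g \<in> K \<Longrightarrow> \<exists>t\<in>T. inv\<^bsub>Diff1 S2\<^esub> t \<otimes>\<^bsub>Diff1 S2\<^esub> g \<in> L"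
  proof (rule finite_transversal[where c = "\<lambda>g. det (tangent_matrix g) > 0" and K = K and H = L])
    show "finite ((\<lambda>g. det (tangent_matrix g) > 0) ` K)" by (rule finite_subset[OF subset_UNIV]) simp
    show "inv\<^bsub>Diff1 S2\<^esub> g \<otimes>\<^bsub>Diff1 S2\<^esub> h \<in> L"
      if gh: "g \<in> K" "h \<in> K" "(det (tangent_matrix g) > 0) = (det (tangent_matrix h) > 0)" for g h
    proof -
      have "det (tangent_matrix (inv\<^bsub>Diff1 S2\<^esub> g)) * det (tangent_matrix h) > 0"
      proof -
        have nz: "det (tangent_matrix g) \<noteq> 0" "det (tangent_matrix h) \<noteq> 0" using det_inv[OF gh(1)] det_inv[OF gh(2)] by auto
        then have "det (tangent_matrix (inv\<^bsub>Diff1 S2\<^esub> g)) = 1 / det (tangent_matrix g)"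
          using det_inv[OF gh(1)] by (simp add: eq_divide_eq)
        moreover have "det (tangent_matrix h) < 0 \<and> det (tangent_matrix g) < 0" if "\<not> 0 < det (tangent_matrix h)"
          using that nz gh(3) by linarith
        ultimately show ?thesis using gh(3) by (auto simp: zero_less_divide_iff)
      qed
      then show ?thesis
        using gh by (simp add: L_def tangent_matrix_mult fixers_inv det_mul F)
    qed
  qed (use K.subset in auto)
  obtain C where C: "finite C" "C \<subseteq> L" "generate (Diff1 S2) C = L"
    using schreier[OF B(1,2) L _ T(1)] T(2,3) unfolding B(3) L_def by auto
  have perL: "periodic_in (Diff1 S2) L"
    using per by (auto simp: periodic_in_def L_def)
  have "finite L"
    unfolding C(3)[symmetric]
  proof (rule finite_abelian_periodic[OF C(1) L C(2)])
    show "\<exists>n>0. g [^]\<^bsub>Diff1 S2\<^esub> (n::nat) = \<one>\<^bsub>Diff1 S2\<^esub>" if "g \<in> L" for g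
      using perL that unfolding periodic_in_def by blast
    show "g \<otimes>\<^bsub>Diff1 S2\<^esub> h = h \<otimes>\<^bsub>Diff1 S2\<^esub> g" if "g \<in> L" "h \<in> L" for g h
      by (rule periodic_orientation_preserving_commute[OF L _ perL _ that]) (use F in \<open>auto simp: L_def\<close>)
  qed
  then show "finite K"
    using finite_if_finite_index[OF K.subset T] by blast
qed

end

lemma tangent_frame_exists:
  assumes "x \<in> S2" obtains u where "tangent_frame x u (cross3 x u)"
proof -
  obtain y :: "real^3" where y: "y \<noteq> 0" "orthogonal x y"
    using orthogonal_to_vector_exists[of x] by auto
  have "tangent_frame x (sgn y) (cross3 x (sgn y))"
    by unfold_locales (use assms y in \<open>auto simp: norm_sgn orthogonal_def sgn_div_norm\<close>)
  then show thesis by (rule that)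
qed

section \<open>Periodic groups with a finite orbit\<close>

text \<open>
  The stabiliser of \<open>x\<close> has finite index because its left cosets correspond to the points of the orbit.
\<close>

theorem theorem1:
  fixes \<Gamma> :: "(real^3 \<Rightarrow> real^3) set"
  assumes "subgroup \<Gamma> (Diff1 S2)"
    and "finitely_generated_in (Diff1 S2) \<Gamma>"
    and "periodic_in (Diff1 S2) \<Gamma>"
  shows "((\<exists>x\<in>S2. finite {g x | g. g \<in> \<Gamma>}) \<longrightarrow> finite \<Gamma>) \<and>
    ((\<forall>g\<in>\<Gamma>. orientation_preserving g) \<and> (\<exists>x\<in>S2. \<forall>g\<in>\<Gamma>. g x = x)
      \<longrightarrow> comm_group (Diff1 S2\<lparr>carrier := \<Gamma>\<rparr>))"
proof (intro conjI impI)
  interpret group "Diff1 S2" by (rule group_Diff1)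
  interpret \<Gamma>: subgroup \<Gamma> "Diff1 S2" by (rule assms(1))
  have \<Gamma>C: "g \<in> C1_diffeos S2" if "g \<in> \<Gamma>" for g
    using that \<Gamma>.mem_carrier Diff1_carrier by blast
  {
    assume "\<exists>x\<in>S2. finite {g x | g. g \<in> \<Gamma>}"
    then obtain x where x: "x \<in> S2" and fin: "finite {g x | g. g \<in> \<Gamma>}" by blast
    obtain u where "tangent_frame x u (cross3 x u)" using tangent_frame_exists[OF x] .
    then interpret tangent_frame x u "cross3 x u" .
    obtain A where A: "finite A" "A \<subseteq> carrier (Diff1 S2)" "generate (Diff1 S2) A = \<Gamma>"
      using assms(2) unfolding finitely_generated_in_def by blast
    define K where "K = \<Gamma> \<inter> fixers"
    have K: "subgroup K (Diff1 S2)"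
    proof (rule subgroupI)
      show "K \<subseteq> carrier (Diff1 S2)" using \<Gamma>.subset by (auto simp: K_def)
      show "K \<noteq> {}" using IntI[OF \<Gamma>.one_closed fixers_one] unfolding K_def by blast
    qed (auto simp: K_def fixers_inv fixers_mult)
    obtain T where T: "finite T" "T \<subseteq> \<Gamma>" "\<And>g. g \<in> \<Gamma> \<Longrightarrow> \<exists>t\<in>T. inv\<^bsub>Diff1 S2\<^esub> t \<otimes>\<^bsub>Diff1 S2\<^esub> g \<in> K"
    proof (rule finite_transversal[where c = "\<lambda>g. g x" and K = \<Gamma> and H = K])
      show "finite ((\<lambda>g. g x) ` \<Gamma>)" using fin by (simp add: setcompr_eq_image)
      show "inv\<^bsub>Diff1 S2\<^esub> g \<otimes>\<^bsub>Diff1 S2\<^esub> h \<in> K" if gh: "g \<in> \<Gamma>" "h \<in> \<Gamma>" "g x = h x" for g h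
      proof -
        define k where "k = inv\<^bsub>Diff1 S2\<^esub> g \<otimes>\<^bsub>Diff1 S2\<^esub> h"
        have k: "k \<in> \<Gamma>" using gh by (simp add: k_def)
        have "g \<otimes>\<^bsub>Diff1 S2\<^esub> k = h" using gh by (simp add: k_def m_assoc[symmetric])
        then have "g (k x) = g x" using gh k x by (metis Diff1_mult \<Gamma>C compose_eq)
        moreover have "inj_on g S2" using \<Gamma>C[OF gh(1)] by (simp add: C1_diffeos_def Bij_def bij_betw_def)
        moreover have "k x \<in> S2" using C1_diffeos_image[OF \<Gamma>C[OF k]] x by blast
        ultimately have "k x = x" using x by (meson inj_onD)
        then show ?thesis using k \<Gamma>C unfolding k_def[symmetric] K_def fixers_def by blast
      qed
    qed (use \<Gamma>.subset in auto)
    obtain B where B: "finite B" "B \<subseteq> K" "generate (Diff1 S2) B = K"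
      using schreier[OF A(1,2) K _ T(1)] T(2,3) unfolding A(3) K_def by auto
    have "periodic_in (Diff1 S2) K" using assms(3) by (auto simp: periodic_in_def K_def)
    then have "finite K"
      using finite_periodic_fixing_group[OF K _ _ B(1) _ B(3)] B(2) subgroup.subset[OF K]
      by (auto simp: K_def)
    then show "finite \<Gamma>"
      using finite_if_finite_index[OF \<Gamma>.subset T] by blast
  next
    assume asm: "(\<forall>g\<in>\<Gamma>. orientation_preserving g) \<and> (\<exists>x\<in>S2. \<forall>g\<in>\<Gamma>. g x = x)"
    then obtain x where x: "x \<in> S2" "\<And>g. g \<in> \<Gamma> \<Longrightarrow> g x = x" by blast
    obtain u where "tangent_frame x u (cross3 x u)" using tangent_frame_exists[OF x(1)] .
    then interpret tangent_frame x u "cross3 x u" .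
    have F: "\<Gamma> \<subseteq> fixers" using x \<Gamma>C by (auto simp: fixers_def)
    have "g \<otimes>\<^bsub>Diff1 S2\<^esub> h = h \<otimes>\<^bsub>Diff1 S2\<^esub> g" if "g \<in> \<Gamma>" "h \<in> \<Gamma>" for g h
      by (rule periodic_orientation_preserving_commute[OF assms(1) F assms(3) _ that])
        (use F asm det_tangent_matrix_pos_if_orientation_preserving in blast)
    then show "comm_group (Diff1 S2\<lparr>carrier := \<Gamma>\<rparr>)"
      by (intro group.group_comm_groupI \<Gamma>.subgroup_is_group group_axioms) auto
  }
qed
end
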